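(* Let $x^0\in L^\infty(I,\mathbb{R}^d)$ with $\|x^0\|_{L^\infty(I,\mathbb{R}^d)}\leq R$ for some $R>0$. Let $a:\mathbb{R}_+\times I\times I\to[0,1]$ be Lebesgue measurable and let $\phi:\mathbb{R}_+\to(0,+\infty)$ be locally Lipschitz continuous, positive and bounded. Assume that for almost every $t\geq 0$ the kernel $a(t)$ is symmetric, i.e. $a(t,i,j)=a(t,j,i)$ for almost every $(i,j)\in I\times I$. Suppose that there exist $\tau>0$ and $\mu\in(0,1]$ such that $$\lambda_2\Big(\frac{1}{\tau}\int_t^{t+\tau}\mathbb{L}^a(s)\,\mathrm{d}s\Big)\geq\mu\qquad\text{for all } t\geq 0 .$$ Let $x(\cdot)\in\mathrm{Lip}_{\mathrm{loc}}(\mathbb{R}_+,L^2(I,\mathbb{R}^d))$ be the solution of $$\partial_t x(t,i)=\int_I a(t,i,j)\,\phi(|x(t,i)-x(t,j)|)\,(x(t,j)-x(t,i))\,\mathrm{d}j,\qquad x(0)=x^0 .$$ Then there exist constants $\alpha,\gamma>0$ depending only on $(\phi(\cdot),R,\tau,\mu)$ such that $$\|x(t)-\bar{x}^0\|_{L^2(I,\mathbb{R}^d)}\leq\alpha\,\|x(0)-\bar{x}^0\|_{L^2(I,\mathbb{R}^d)}\exp(-\gamma\mu t)\qquad\text{for all } t\geq 0 .$$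
   Context: $I:=[0,1]$ with the Lebesgue measure, $d\geq 1$ is an integer, $\mathbb{R}_+=[0,+\infty)$. The graphon dynamics is understood for almost every $t\geq 0$ and almost every $i\in I$. $\bar{x}^0:=\int_I x^0(i)\,\mathrm{d}i\in\mathbb{R}^d$ is the initial barycenter, identified with a constant function on $I$. For almost every $t\geq 0$, the graph-Laplacian $\mathbb{L}^a(t)$ is the bounded linear operator on $L^2(I,\mathbb{R}^d)$ given by $(\mathbb{L}^a(t)y)(i):=\int_I a(t,i,j)(y(i)-y(j))\,\mathrm{d}j$. The averaged operator $\frac1\tau\int_t^{t+\tau}\mathbb{L}^a(s)\,\mathrm{d}s$ is the operator $y\mapsto\frac1\tau\int_t^{t+\tau}\mathbb{L}^a(s)y\,\mathrm{d}s$. Let $\mathscr{C}\subset L^2(I,\mathbb{R}^d)$ be the subspace of constant functions (consensus manifold), so that $\mathscr{C}^\perp=\{x\in L^2(I,\mathbb{R}^d):\int_I x(i)\,\mathrm{d}i=0\}$. For a bounded linear operator $T$ on $L^2(I,\mathbb{R}^d)$, $$\lambda_2(T):=\inf_{x\in\mathscr{C}^\perp\setminus\{0\}}\frac{\langle Tx,x\rangle_{L^2(I,\mathbb{R}^d)}}{\|x\|^2_{L^2(I,\mathbb{R}^d)}} .$$ *)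

theory Defs
  imports "HOL-Analysis.Analysis" "HOL-Probability.Essential_Supremum"
begin

text \<open>
  The dimension \<open>d\<close> is a natural number and not a type, because the constants of the theorem
  must not depend on it. A vector of \<open>\<real>\<^sup>d\<close> is a function \<open>v :: nat \<Rightarrow> real\<close> of which only the
  components \<open>v k\<close> with \<open>k < d\<close> are ever used. An element of \<open>L\<^sup>2(I, \<real>\<^sup>d)\<close> is
  given by a representative \<open>f :: real \<Rightarrow> nat \<Rightarrow> real\<close>, of which only the values on
  \<open>I = [0,1]\<close> matter, and these up to null sets.
\<close>

abbreviation unit_leb :: "real measure" where
  "unit_leb \<equiv> lebesgue_on {0..1}"

definition vnorm :: "nat \<Rightarrow> (nat \<Rightarrow> real) \<Rightarrow> real" where
  "vnorm d v = L2_set v {..<d}"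

definition L2_space :: "nat \<Rightarrow> (real \<Rightarrow> nat \<Rightarrow> real) set" where
  "L2_space d = {f. (\<forall>k<d. (\<lambda>i. f i k) \<in> borel_measurable unit_leb) \<and>
                    integrable unit_leb (\<lambda>i. (vnorm d (f i))\<^sup>2)}"

definition L2_inner :: "nat \<Rightarrow> (real \<Rightarrow> nat \<Rightarrow> real) \<Rightarrow> (real \<Rightarrow> nat \<Rightarrow> real) \<Rightarrow> real" where
  "L2_inner d f g = (LINT i|unit_leb. (\<Sum>k<d. f i k * g i k))"

definition L2_norm :: "nat \<Rightarrow> (real \<Rightarrow> nat \<Rightarrow> real) \<Rightarrow> real" where
  "L2_norm d f = sqrt (LINT i|unit_leb. (vnorm d (f i))\<^sup>2)"

definition L2_eq :: "nat \<Rightarrow> (real \<Rightarrow> nat \<Rightarrow> real) \<Rightarrow> (real \<Rightarrow> nat \<Rightarrow> real) \<Rightarrow> bool" where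
  "L2_eq d f g \<longleftrightarrow> (AE i in unit_leb. \<forall>k<d. f i k = g i k)"

definition Linf_norm :: "nat \<Rightarrow> (real \<Rightarrow> nat \<Rightarrow> real) \<Rightarrow> ereal" where
  "Linf_norm d f = esssup unit_leb (\<lambda>i. ereal (vnorm d (f i)))"

definition Linf_space :: "nat \<Rightarrow> (real \<Rightarrow> nat \<Rightarrow> real) set" where
  "Linf_space d = {f. (\<forall>k<d. (\<lambda>i. f i k) \<in> borel_measurable unit_leb) \<and> Linf_norm d f < \<infinity>}"

definition barycenter :: "(real \<Rightarrow> nat \<Rightarrow> real) \<Rightarrow> nat \<Rightarrow> real" where
  "barycenter f k = (LINT i|unit_leb. f i k)"

definition consensus :: "nat \<Rightarrow> (real \<Rightarrow> nat \<Rightarrow> real) set" where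
  "consensus d = {f \<in> L2_space d. \<exists>c. L2_eq d f (\<lambda>_. c)}"

definition consensus_perp :: "nat \<Rightarrow> (real \<Rightarrow> nat \<Rightarrow> real) set" where
  "consensus_perp d = {f \<in> L2_space d. \<forall>g\<in>consensus d. L2_inner d f g = 0}"

text \<open>
  The infimum is one of real numbers, so it is meaningful for operators \<open>T\<close> whose Rayleigh
  quotients are bounded below (in particular for bounded \<open>T\<close>), and for \<open>d \<ge> 1\<close>.
\<close>

definition lambda2 :: "nat \<Rightarrow> ((real \<Rightarrow> nat \<Rightarrow> real) \<Rightarrow> (real \<Rightarrow> nat \<Rightarrow> real)) \<Rightarrow> real" where
  "lambda2 d T = (INF y \<in> {y \<in> consensus_perp d. \<not> L2_eq d y (\<lambda>_ _. 0)}.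
                    L2_inner d (T y) y / (L2_norm d y)\<^sup>2)"

definition graph_laplacian ::
    "(real \<Rightarrow> real \<Rightarrow> real \<Rightarrow> real) \<Rightarrow> real \<Rightarrow> (real \<Rightarrow> nat \<Rightarrow> real) \<Rightarrow> (real \<Rightarrow> nat \<Rightarrow> real)" where
  "graph_laplacian a t y i k = (LINT j|unit_leb. a t i j * (y i k - y j k))"

text \<open>
  The integral over \<open>s\<close> of the \<open>L\<^sup>2\<close>-valued map \<open>s \<mapsto> L s y\<close> is taken pointwise in \<open>i\<close>. For maps
  that are jointly measurable in \<open>(s, i)\<close> and bounded in \<open>L\<^sup>2\<close>, such as the graph Laplacian of a
  measurable bounded kernel, this is a representative of the Bochner integral in \<open>L\<^sup>2\<close>.
\<close>

definition averaged_operator ::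
    "(real \<Rightarrow> (real \<Rightarrow> nat \<Rightarrow> real) \<Rightarrow> (real \<Rightarrow> nat \<Rightarrow> real)) \<Rightarrow> real \<Rightarrow> real \<Rightarrow>
     (real \<Rightarrow> nat \<Rightarrow> real) \<Rightarrow> (real \<Rightarrow> nat \<Rightarrow> real)" where
  "averaged_operator L \<tau> t y i k = 1 / \<tau> * (LINT s|lebesgue_on {t..t+\<tau>}. L s y i k)"

definition locally_lipschitz_fun :: "(real \<Rightarrow> real) \<Rightarrow> bool" where
  "locally_lipschitz_fun \<phi> \<longleftrightarrow>
     (\<forall>r\<ge>0. \<exists>u>0. \<exists>C. C-lipschitz_on (cball r u \<inter> {0..}) \<phi>)"

definition Lip_loc_L2 :: "nat \<Rightarrow> (real \<Rightarrow> real \<Rightarrow> nat \<Rightarrow> real) \<Rightarrow> bool" where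
  "Lip_loc_L2 d x \<longleftrightarrow>
     (\<forall>t\<ge>0. x t \<in> L2_space d) \<and>
     (\<forall>t\<ge>0. \<exists>u>0. \<exists>C. \<forall>s \<in> cball t u \<inter> {0..}. \<forall>s' \<in> cball t u \<inter> {0..}.
        L2_norm d (x s - x s') \<le> C * \<bar>s - s'\<bar>)"

text \<open>
  The values \<open>x t\<close> are classes modulo null sets, so \<open>\<partial>\<^sub>t x(t)\<close> is the derivative of the
  \<open>L\<^sup>2\<close>-valued map. The membership \<open>y \<in> L2_space d\<close> is needed, since the integral in
  \<open>L2_norm\<close> is 0 for a non-integrable function.
\<close>

definition has_L2_derivative ::
    "nat \<Rightarrow> (real \<Rightarrow> real \<Rightarrow> nat \<Rightarrow> real) \<Rightarrow> (real \<Rightarrow> nat \<Rightarrow> real) \<Rightarrow> real \<Rightarrow> bool" where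
  "has_L2_derivative d x y t \<longleftrightarrow>
     y \<in> L2_space d \<and>
     ((\<lambda>s. L2_norm d (\<lambda>i k. (x s i k - x t i k) / (s - t) - y i k)) \<longlongrightarrow> 0) (at t within {0..})"

definition graphon_field ::
    "nat \<Rightarrow> (real \<Rightarrow> real \<Rightarrow> real \<Rightarrow> real) \<Rightarrow> (real \<Rightarrow> real) \<Rightarrow> real \<Rightarrow>
     (real \<Rightarrow> nat \<Rightarrow> real) \<Rightarrow> (real \<Rightarrow> nat \<Rightarrow> real)" where
  "graphon_field d a \<phi> t y i k =
     (LINT j|unit_leb. a t i j * \<phi> (vnorm d (y i - y j)) * (y j k - y i k))"

definition graphon_solution ::
    "nat \<Rightarrow> (real \<Rightarrow> real \<Rightarrow> real \<Rightarrow> real) \<Rightarrow> (real \<Rightarrow> real) \<Rightarrow> (real \<Rightarrow> nat \<Rightarrow> real) \<Rightarrow>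
     (real \<Rightarrow> real \<Rightarrow> nat \<Rightarrow> real) \<Rightarrow> bool" where
  "graphon_solution d a \<phi> x0 x \<longleftrightarrow>
     Lip_loc_L2 d x \<and> L2_eq d (x 0) x0 \<and>
     (AE t in lebesgue_on {0..}. has_L2_derivative d x (graphon_field d a \<phi> t (x t)) t)"

definition measurable_kernel :: "(real \<Rightarrow> real \<Rightarrow> real \<Rightarrow> real) \<Rightarrow> bool" where
  "measurable_kernel a \<longleftrightarrow>
     (\<lambda>(t, i, j). a t i j) \<in> borel_measurable (lebesgue_on ({0..} \<times> {0..1} \<times> {0..1})) \<and>
     (\<forall>t\<ge>0. \<forall>i\<in>{0..1}. \<forall>j\<in>{0..1}. a t i j \<in> {0..1})"

definition symmetric_kernel :: "(real \<Rightarrow> real \<Rightarrow> real \<Rightarrow> real) \<Rightarrow> bool" where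
  "symmetric_kernel a \<longleftrightarrow>
     (AE t in lebesgue_on {0..}.
        AE (i, j) in lebesgue_on ({0..1} \<times> {0..1}). a t i j = a t j i)"

lemma L2_space_component_integrable:
  assumes f: "f \<in> L2_space d" and k: "k < d"
  shows "integrable unit_leb (\<lambda>i. f i k)"
proof -
  have m: "(\<lambda>i. f i k) \<in> borel_measurable unit_leb"
    and q: "integrable unit_leb (\<lambda>i. (vnorm d (f i))\<^sup>2)"
    using f k by (auto simp: L2_space_def)
  have c: "integrable unit_leb (\<lambda>i. 1 :: real)"
    by (rule finite_measure.integrable_const) (auto intro: finite_measure_lebesgue_on)
  have "norm (f i k) \<le> norm (1 + (vnorm d (f i))\<^sup>2)" for i
  proof -
    have "\<bar>f i k\<bar> \<le> vnorm d (f i)"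
      unfolding vnorm_def using member_le_L2_set[of "{..<d}" k "\<lambda>k. \<bar>f i k\<bar>"] k
      by (auto simp: L2_set_def)
    moreover have "vnorm d (f i) \<le> 1 + (vnorm d (f i))\<^sup>2"
      using sum_squares_bound[of 1 "vnorm d (f i)"] zero_le_power2[of "vnorm d (f i)"]
      unfolding one_power2 by linarith
    ultimately show ?thesis by simp
  qed
  then show ?thesis
    by (intro Bochner_Integration.integrable_bound[OF Bochner_Integration.integrable_add[OF c q] m]) auto
qed

lemma consensus_perp_eq_zero_mean:
  "consensus_perp d = {f \<in> L2_space d. \<forall>k<d. barycenter f k = 0}"
proof (intro equalityI subsetI)
  fix f assume f: "f \<in> consensus_perp d"
  have "barycenter f k = 0" if k: "k < d" for k
  proof -
    let ?g = "\<lambda>(_ :: real) l. if l = k then 1 else 0 :: real"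
    have "?g \<in> consensus d"
      by (auto simp: consensus_def L2_space_def L2_eq_def vnorm_def
          intro!: exI[of _ "\<lambda>l. if l = k then 1 else 0"] AE_I2
            finite_measure.integrable_const finite_measure_lebesgue_on)
    then have "L2_inner d f ?g = 0"
      using f by (simp add: consensus_perp_def)
    then show ?thesis
      using k by (simp add: L2_inner_def barycenter_def if_distrib cong: if_cong)
  qed
  then show "f \<in> {f \<in> L2_space d. \<forall>k<d. barycenter f k = 0}"
    using f by (auto simp: consensus_perp_def)
next
  fix f assume "f \<in> {f \<in> L2_space d. \<forall>k<d. barycenter f k = 0}"
  then have f: "f \<in> L2_space d" and z: "\<And>k. k < d \<Longrightarrow> barycenter f k = 0" by auto
  have fm: "(\<lambda>i. f i k) \<in> borel_measurable unit_leb" if "k < d" for k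
    using f that by (auto simp: L2_space_def)
  have "L2_inner d f g = 0" if "g \<in> consensus d" for g
  proof -
    from that obtain c where g: "g \<in> L2_space d" and c: "AE i in unit_leb. \<forall>k<d. g i k = c k"
      by (auto simp: consensus_def L2_eq_def)
    have gm: "(\<lambda>i. g i k) \<in> borel_measurable unit_leb" if "k < d" for k
      using g that by (auto simp: L2_space_def)
    have "L2_inner d f g = (LINT i|unit_leb. (\<Sum>k<d. f i k * c k))"
      unfolding L2_inner_def
    proof (rule integral_cong_AE)
      show "AE i in unit_leb. (\<Sum>k<d. f i k * g i k) = (\<Sum>k<d. f i k * c k)"
        using c by eventually_elim simp
    qed (auto intro!: borel_measurable_sum borel_measurable_times fm gm)
    also have "\<dots> = (\<Sum>k<d. (LINT i|unit_leb. f i k * c k))"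
      by (rule Bochner_Integration.integral_sum)
        (auto intro: L2_space_component_integrable[OF f])
    also have "\<dots> = 0"
      using z by (simp add: barycenter_def)
    finally show ?thesis .
  qed
  then show "f \<in> consensus_perp d"
    using f by (simp add: consensus_perp_def)
qed

end

theory Submission
  imports Defs "HOL-Probability.Probability_Measure" "HOL-Library.Function_Algebras"
begin

text \<open>
  Truncation at radius \<open>R\<close> is half the gradient of the convex function \<open>(\<bar>v\<bar> - R)\<^sub>+\<^sup>2\<close>, hence monotone,
  so by symmetry of the kernel the integral of this function does not increase along the flow and
  \<open>\<bar>x t\<bar> \<le> R\<close> for all times. Thus \<open>\<phi>\<close> is only evaluated on \<open>[0, 2R]\<close>, where it is at least some \<open>m > 0\<close>.
  The barycenter is conserved, and \<open>V t = \<parallel>x t - c\<parallel>\<^sup>2\<close>, for \<open>c\<close> the barycenter, has derivative \<open>- D t\<close>,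
  where \<open>D\<close> is the weighted Dirichlet energy. Let \<open>M\<close> bound \<open>\<phi>\<close> and let \<open>E = V t - V (t + \<tau>)\<close>.
  On \<open>[t, t + \<tau>]\<close> the solution moves by at most \<open>sqrt (M * \<tau> * E)\<close>. Freezing the state at
  time \<open>t\<close> in the energy therefore turns the spectral gap of the averaged Laplacian into
  \<open>2 \<tau> \<mu> V t \<le> (2 / m + 8 M \<tau>\<^sup>2) E\<close>, so \<open>V\<close> contracts by a fixed factor on every window of length \<open>\<tau>\<close>.

  The maps \<open>x t\<close> are representatives without joint measurability in time and space. So the
  equation is only used through real functions \<open>\<Phi> (x t)\<close>, which are Lipschitz in \<open>t\<close>.
\<close>

section \<open>Lipschitz functions and their derivatives\<close>

text \<open>The constants come from one comparison. With \<open>y = x t\<close> and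
  \<open>z = x t - x s\<close>, the squared differences of \<open>y\<close> are at most twice those
  of \<open>x s\<close> plus twice those of \<open>z\<close>. The first part is at most
  \<open>2 / m\<close> times the dissipation and integrates to \<open>2 / m * E\<close>. The second
  is at most \<open>2 * 4\<close> times the squared norm of \<open>z\<close>, hence
  \<open>8 * M * \<tau> * E\<close> at each time, and the window contributes one more factor
  \<open>\<tau>\<close>. The left side \<open>2 * \<tau> * \<mu> * V t\<close> is the gap inequality
  with the factor 1/2 of the Dirichlet form and the average over the window undone. Two obstacles
  shape the proof. The dissipation is never integrated in time: every estimate is stated as a lower
  bound for the derivative of a single functional, by a function whose integrability is known (a
  constant, or the energy of a frozen state). And the kernel is only Lebesgue measurable in its
  three variables jointly, so it is exchanged for a Borel version before any use of Fubini.\<close>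

lemma integral_shifted_window:
  fixes h :: "real \<Rightarrow> real"
  assumes lip: "C-lipschitz_on UNIV h" and e: "0 < e"
  shows "\<bar>integral {c..c+e} h / e - h c\<bar> \<le> C * e"
proof -
  have cont: "continuous_on S h" for S
    using lipschitz_on_continuous_on[OF lip] continuous_on_subset by blast
  have C0: "0 \<le> C" using lip by (rule lipschitz_on_nonneg)
  have "norm (integral {c..c+e} (\<lambda>t. h t - h c)) \<le> (C * e) * (c + e - c)"
  proof (rule integral_bound)
    show "c \<le> c + e" using e by simp
    show "continuous_on {c..c+e} (\<lambda>t. h t - h c)" by (intro continuous_intros cont)
    fix t assume t: "t \<in> {c..c+e}"
    have "norm (h t - h c) \<le> C * \<bar>t - c\<bar>"
      using lipschitz_onD[OF lip, of t c] by (simp add: dist_norm)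
    also have "\<dots> \<le> C * e" using t C0 by (intro mult_left_mono) auto
    finally show "norm (h t - h c) \<le> C * e" .
  qed
  moreover have "integral {c..c+e} (\<lambda>t. h t - h c) = integral {c..c+e} h - e * h c"
    using e by (subst Henstock_Kurzweil_Integration.integral_diff)
      (auto intro!: integrable_continuous_interval cont)
  moreover have "integral {c..c+e} h / e - h c = (integral {c..c+e} h - e * h c) / e"
    using e by (simp add: field_simps)
  ultimately show ?thesis using e by (simp add: abs_divide field_simps)
qed

text \<open>
  The derivative of \<open>h\<close> is the limit of its difference quotients, which are bounded; their integrals
  converge to \<open>h b - h a\<close> because \<open>h\<close> is continuous. This replaces Lebesgue's differentiation theorem.
\<close>

lemma lipschitz_integral_le:
  fixes h A :: "real \<Rightarrow> real"
  assumes ab: "a \<le> b" and lip: "C-lipschitz_on {a..b} h"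
    and A: "integrable (lebesgue_on {a..b}) A"
    and der: "AE t in lebesgue_on {a..b}. \<exists>D. (h has_real_derivative D) (at t) \<and> A t \<le> D"
  shows "(LINT t|lebesgue_on {a..b}. A t) \<le> h b - h a"
proof -
  \<comment> \<open>\<open>h\<close> is continued by its end values, so difference quotients that
    reach beyond \<open>b\<close> make sense and the Lipschitz constant is kept.\<close>
  define H where "H t = h (max a (min b t))" for t
  have HC: "C-lipschitz_on UNIV H"
  proof (rule lipschitz_onI)
    show "0 \<le> C" using lip by (rule lipschitz_on_nonneg)
    fix s t :: real
    have "dist (H s) (H t) \<le> C * dist (max a (min b s)) (max a (min b t))"
      unfolding H_def using ab by (intro lipschitz_onD[OF lip]) auto
    also have "\<dots> \<le> C * dist s t"
      using \<open>0 \<le> C\<close> by (intro mult_left_mono) (auto simp: dist_real_def)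
    finally show "dist (H s) (H t) \<le> C * dist s t" .
  qed
  have contH: "continuous_on S H" for S
    using lipschitz_on_continuous_on[OF HC] continuous_on_subset by blast
  define g where "g n t = (H (t + inverse (Suc n)) - H t) / inverse (Suc n)" for n :: nat and t
  \<comment> \<open>\<open>lim\<close> is total, so \<open>G\<close> is Borel on the whole line; at
    almost every point of the interval it is the derivative of \<open>h\<close>.\<close>
  define G where "G t = lim (\<lambda>n. g n t)" for t
  have gb: "\<bar>g n t\<bar> \<le> C" for n t
  proof -
    have "\<bar>H (t + inverse (Suc n)) - H t\<bar> \<le> C * inverse (Suc n)"
      using lipschitz_onD[OF HC, of "t + inverse (Suc n)" t] by (simp add: dist_real_def)
    then show ?thesis
      unfolding g_def abs_divide by (subst pos_divide_le_eq) auto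
  qed
  have contg: "continuous_on S (g n)" for S n
    unfolding g_def by (intro continuous_intros continuous_on_compose2[OF contH]) auto
  have gm: "g n \<in> borel_measurable borel" for n
    by (rule borel_measurable_continuous_onI[OF contg])
  have Gm: "G \<in> borel_measurable borel"
    unfolding G_def by (rule borel_measurable_lim_metric[OF gm])
  have leb: "f \<in> borel_measurable (lebesgue_on {a..b})" if "f \<in> borel_measurable borel" for f :: "real \<Rightarrow> real"
    using that by (simp add: measurable_completion measurable_restrict_space1)
  have ne: "AE t in lebesgue_on {a..b}. t \<noteq> b \<and> t \<noteq> a"
    using AE_lborel_singleton[of a] AE_lborel_singleton[of b]
    by (subst AE_restrict_space_iff) (auto simp: AE_completion_iff)
  have conv: "AE t in lebesgue_on {a..b}. (\<lambda>n. g n t) \<longlonglongrightarrow> G t \<and> A t \<le> G t"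
    using der ne AE_space
  proof eventually_elim
    case (elim t)
    then obtain D where D: "(h has_real_derivative D) (at t)" and AD: "A t \<le> D" by blast
    from elim have t: "a < t" "t < b" by auto
    have "(H has_real_derivative D) (at t)"
    proof (rule has_field_derivative_transform_within_open[OF D])
      show "open {a<..<b}" "t \<in> {a<..<b}" using t by auto
    qed (auto simp: H_def)
    then have "((\<lambda>e. (H (t + e) - H t) / e) \<longlongrightarrow> D) (at 0)" by (simp add: DERIV_def)
    then have "(\<lambda>n. g n t) \<longlonglongrightarrow> D" unfolding g_def
      by (rule tendsto_compose_eventually)
        (use LIMSEQ_inverse_real_of_nat in auto)
    then show ?case using AD by (auto simp: G_def limI)
  qed
  have dom: "integrable (lebesgue_on {a..b}) (\<lambda>_. C)"
    by (rule finite_measure.integrable_const) (auto intro: finite_measure_lebesgue_on)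
  have conv': "AE t in lebesgue_on {a..b}. (\<lambda>n. g n t) \<longlonglongrightarrow> G t"
    using conv by eventually_elim simp
  have gb': "AE t in lebesgue_on {a..b}. norm (g n t) \<le> C" for n
    using gb by (intro AE_I2) simp
  have "(LINT t|lebesgue_on {a..b}. A t) \<le> (LINT t|lebesgue_on {a..b}. G t)"
  proof (rule integral_mono_AE[OF A])
    show "integrable (lebesgue_on {a..b}) G"
      by (rule integrable_dominated_convergence[OF leb[OF Gm] leb[OF gm] dom conv' gb'])
    show "AE t in lebesgue_on {a..b}. A t \<le> G t"
      using conv by eventually_elim simp
  qed
  moreover have "(\<lambda>n. LINT t|lebesgue_on {a..b}. g n t) \<longlonglongrightarrow> (LINT t|lebesgue_on {a..b}. G t)"
    by (rule integral_dominated_convergence[OF leb[OF Gm] leb[OF gm] dom conv' gb'])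
  moreover have "(\<lambda>n. LINT t|lebesgue_on {a..b}. g n t) \<longlonglongrightarrow> h b - h a"
  proof (rule LIM_zero_cancel, rule Lim_null_comparison)
    show "(\<lambda>n. norm ((2 * C) * inverse (real (Suc n)))) \<longlonglongrightarrow> 0"
      using tendsto_norm[OF tendsto_mult_left[OF LIMSEQ_inverse_real_of_nat, of "2*C"]] by simp
    show "\<forall>\<^sub>F n in sequentially. norm ((LINT t|lebesgue_on {a..b}. g n t) - (h b - h a)) \<le> norm ((2 * C) * inverse (real (Suc n)))"
    proof (intro always_eventually allI)
      fix n
      define e where "e = inverse (real (Suc n))"
      have e: "0 < e" by (simp add: e_def)
      have int: "H integrable_on {u..v}" for u v by (rule integrable_continuous_interval[OF contH])
      have shift_int: "(\<lambda>t. H (t + e)) integrable_on {a..b}"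
        by (intro integrable_continuous_interval continuous_on_compose2[OF contH] continuous_intros) auto
      have "(LINT t|lebesgue_on {a..b}. g n t) = integral {a..b} (g n)"
        by (rule lebesgue_integral_eq_integral)
          (auto intro!: Bochner_Integration.integrable_bound[OF dom leb[OF gm]] AE_I2
            intro: order_trans[OF gb abs_ge_self])
      also have "\<dots> = (integral {a..b} (\<lambda>t. H (t + e)) - integral {a..b} H) / e"
        unfolding g_def e_def[symmetric]
        using Henstock_Kurzweil_Integration.integral_diff[OF shift_int int] by simp
      also have "integral {a..b} (\<lambda>t. H (t + e)) = integral {a+e..b+e} H"
        using integral_shift[OF contH, of a b e] by (simp add: o_def)
      \<comment> \<open>Both sides arise by splitting the integral over \<open>{a..b+e}\<close> in
        two ways, which is valid even when \<open>e\<close> exceeds \<open>b - a\<close>. The two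
        remaining windows have averages within \<open>C * e\<close> of \<open>H b\<close> and
        \<open>H a\<close>.\<close>
      also have "integral {a+e..b+e} H - integral {a..b} H = integral {b..b+e} H - integral {a..a+e} H"
        using Henstock_Kurzweil_Integration.integral_combine[of a "a+e" "b+e" H]
          Henstock_Kurzweil_Integration.integral_combine[of a b "b+e" H] int ab e by simp
      finally have *: "(LINT t|lebesgue_on {a..b}. g n t) = integral {b..b+e} H / e - integral {a..a+e} H / e"
        by (simp add: diff_divide_distrib)
      have Hab: "H a = h a" "H b = h b" using ab by (auto simp: H_def)
      have "C \<ge> 0" using lip by (rule lipschitz_on_nonneg)
      then show "norm ((LINT t|lebesgue_on {a..b}. g n t) - (h b - h a)) \<le> norm ((2 * C) * inverse (real (Suc n)))"
        using integral_shifted_window[OF HC e, of a] integral_shifted_window[OF HC e, of b] e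
        unfolding * Hab e_def[symmetric] real_norm_def by (simp add: abs_mult)
    qed
  qed
  ultimately show ?thesis using LIMSEQ_unique by metis
qed

section \<open>The Hilbert space of square-integrable maps\<close>

definition vdot :: "nat \<Rightarrow> (nat \<Rightarrow> real) \<Rightarrow> (nat \<Rightarrow> real) \<Rightarrow> real" where
  "vdot d v w = (\<Sum>k<d. v k * w k)"

lemma vdot_commute: "vdot d v w = vdot d w v"
  by (simp add: vdot_def mult.commute)

lemma vdot_add_left: "vdot d (u + v) w = vdot d u w + vdot d v w"
  by (simp add: vdot_def sum.distrib algebra_simps)

lemma vdot_diff_left: "vdot d (u - v) w = vdot d u w - vdot d v w"
  by (simp add: vdot_def sum_subtractf algebra_simps)

lemma vdot_diff_right: "vdot d w (u - v) = vdot d w u - vdot d w v"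
  by (simp add: vdot_def sum_subtractf algebra_simps)

lemma vdot_scale_left: "vdot d (\<lambda>k. c * v k) w = c * vdot d v w"
  by (simp add: vdot_def sum_distrib_left algebra_simps)

lemma vdot_scale_right: "vdot d w (\<lambda>k. c * v k) = c * vdot d w v"
  by (simp add: vdot_def sum_distrib_left algebra_simps)

lemma vnorm_nonneg [simp]: "0 \<le> vnorm d v"
  by (simp add: vnorm_def)

lemma vnorm_sq: "(vnorm d v)\<^sup>2 = vdot d v v"
  by (simp add: vnorm_def L2_set_def vdot_def sum_nonneg power2_eq_square)

lemma abs_vdot_le: "\<bar>vdot d v w\<bar> \<le> vnorm d v * vnorm d w"
proof -
  have "\<bar>vdot d v w\<bar> \<le> (\<Sum>k<d. \<bar>v k\<bar> * \<bar>w k\<bar>)"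
    unfolding vdot_def by (rule order_trans[OF sum_abs]) (simp add: abs_mult)
  also have "\<dots> \<le> vnorm d v * vnorm d w"
    unfolding vnorm_def by (rule L2_set_mult_ineq)
  finally show ?thesis .
qed

lemma vnorm_diff_sq:
  "(vnorm d (v - w))\<^sup>2 = (vnorm d v)\<^sup>2 - 2 * vdot d v w + (vnorm d w)\<^sup>2"
  unfolding vnorm_sq vdot_diff_left vdot_diff_right by (simp add: vdot_commute)

lemma vnorm_diff_commute: "vnorm d (v - w) = vnorm d (w - v)"
proof -
  have "(vnorm d (v - w))\<^sup>2 = (vnorm d (w - v))\<^sup>2"
    unfolding vnorm_diff_sq by (simp add: vdot_commute)
  then show ?thesis by (simp add: power2_eq_iff_nonneg)
qed

lemma vnorm_diff_le: "vnorm d (v - w) \<le> vnorm d v + vnorm d w"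
proof (rule power2_le_imp_le)
  show "(vnorm d (v - w))\<^sup>2 \<le> (vnorm d v + vnorm d w)\<^sup>2"
    using abs_vdot_le[of d v w] unfolding vnorm_diff_sq power2_sum by (auto simp: abs_le_iff)
qed simp

lemma vnorm_diff_sq_le: "(vnorm d (v - w))\<^sup>2 \<le> 2 * (vnorm d v)\<^sup>2 + 2 * (vnorm d w)\<^sup>2"
proof -
  have "(vnorm d (v - w))\<^sup>2 \<le> (vnorm d v + vnorm d w)\<^sup>2"
    by (intro power_mono vnorm_diff_le) simp
  also have "\<dots> \<le> 2 * (vnorm d v)\<^sup>2 + 2 * (vnorm d w)\<^sup>2"
    using sum_squares_bound[of "vnorm d v" "vnorm d w"] by (simp add: power2_sum)
  finally show ?thesis .
qed

lemma abs_vdot_le_sq: "\<bar>vdot d v w\<bar> \<le> (vnorm d v)\<^sup>2 + (vnorm d w)\<^sup>2"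
  using abs_vdot_le[of d v w] sum_squares_bound[of "vnorm d v" "vnorm d w"]
    mult_nonneg_nonneg[OF vnorm_nonneg[of d v] vnorm_nonneg[of d w]] by linarith

text \<open>The expanded square of \<open>e * vnorm d v - vnorm d w\<close>. The free parameter
  \<open>e\<close> is fixed in \<open>displacement_le\<close>, where the term in \<open>v\<close>
  has to be absorbed.\<close>

lemma vdot_young:
  assumes "0 < e"
  shows "\<bar>vdot d v w\<bar> \<le> e / 2 * (vnorm d v)\<^sup>2 + 1 / (2 * e) * (vnorm d w)\<^sup>2"
proof -
  have "0 \<le> (e * vnorm d v - vnorm d w)\<^sup>2 / (2 * e)" using assms by simp
  also have "\<dots> = e / 2 * (vnorm d v)\<^sup>2 + 1 / (2 * e) * (vnorm d w)\<^sup>2 - vnorm d v * vnorm d w"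
    using assms by (simp add: power2_diff field_simps power2_eq_square)
  finally show ?thesis using abs_vdot_le[of d v w] by linarith
qed

lemma integrable_unit_leb_const [simp]: "integrable unit_leb (\<lambda>_. c :: real)"
  by (rule finite_measure.integrable_const) (auto intro: finite_measure_lebesgue_on)

lemma L2_space_measurable: "f \<in> L2_space d \<Longrightarrow> k < d \<Longrightarrow> (\<lambda>i. f i k) \<in> borel_measurable unit_leb"
  by (simp add: L2_space_def)

lemma vdot_measurable [measurable (raw)]:
  assumes "\<And>k. k < d \<Longrightarrow> (\<lambda>p. f p k) \<in> borel_measurable N"
    and "\<And>k. k < d \<Longrightarrow> (\<lambda>p. g p k) \<in> borel_measurable N"
  shows "(\<lambda>p. vdot d (f p) (g p)) \<in> borel_measurable N"
  unfolding vdot_def using assms by (intro borel_measurable_sum borel_measurable_times) auto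

lemma vnorm_measurable [measurable (raw)]:
  assumes "\<And>k. k < d \<Longrightarrow> (\<lambda>p. f p k) \<in> borel_measurable N"
  shows "(\<lambda>p. vnorm d (f p)) \<in> borel_measurable N"
proof -
  have "(\<lambda>p. sqrt (vdot d (f p) (f p))) \<in> borel_measurable N"
    by (rule measurable_compose[OF vdot_measurable[OF assms assms] borel_measurable_sqrt])
  moreover have "sqrt (vdot d v v) = vnorm d v" for v
    using real_sqrt_unique[OF vnorm_sq vnorm_nonneg] by simp
  ultimately show ?thesis by simp
qed

lemma L2_space_integrable_sq: "f \<in> L2_space d \<Longrightarrow> integrable unit_leb (\<lambda>i. (vnorm d (f i))\<^sup>2)"
  by (simp add: L2_space_def)

lemma L2_spaceI:
  assumes "\<And>k. k < d \<Longrightarrow> (\<lambda>i. f i k) \<in> borel_measurable unit_leb"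
    and "integrable unit_leb g" and "\<And>i. (vnorm d (f i))\<^sup>2 \<le> g i"
  shows "f \<in> L2_space d"
  unfolding L2_space_def mem_Collect_eq
proof
  show "integrable unit_leb (\<lambda>i. (vnorm d (f i))\<^sup>2)"
  proof (rule Bochner_Integration.integrable_bound[OF assms(2)])
    show "(\<lambda>i. (vnorm d (f i))\<^sup>2) \<in> borel_measurable unit_leb"
      by (intro borel_measurable_power vnorm_measurable assms(1))
    show "AE i in unit_leb. norm ((vnorm d (f i))\<^sup>2) \<le> norm (g i)"
      using assms(3) by (intro AE_I2) (auto intro: order_trans[OF _ abs_ge_self])
  qed
qed (use assms(1) in auto)

lemma L2_space_diff:
  assumes "f \<in> L2_space d" "g \<in> L2_space d" shows "f - g \<in> L2_space d"
proof (rule L2_spaceI)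
  show "integrable unit_leb (\<lambda>i. 2 * (vnorm d (f i))\<^sup>2 + 2 * (vnorm d (g i))\<^sup>2)"
    using assms by (intro Bochner_Integration.integrable_add integrable_mult_right L2_space_integrable_sq)
  show "(vnorm d ((f - g) i))\<^sup>2 \<le> 2 * (vnorm d (f i))\<^sup>2 + 2 * (vnorm d (g i))\<^sup>2" for i
    using vnorm_diff_sq_le by simp
  show "(\<lambda>i. (f - g) i k) \<in> borel_measurable unit_leb" if "k < d" for k
    using borel_measurable_diff[OF L2_space_measurable[OF assms(1) that] L2_space_measurable[OF assms(2) that]]
    by simp
qed

lemma vnorm_scale: "vnorm d (\<lambda>k. c * v k) = \<bar>c\<bar> * vnorm d v"
proof -
  have "(vnorm d (\<lambda>k. c * v k))\<^sup>2 = (\<bar>c\<bar> * vnorm d v)\<^sup>2"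
    unfolding power_mult_distrib vnorm_sq vdot_scale_left vdot_scale_right
    by (simp add: power2_eq_square)
  then show ?thesis by (simp add: power2_eq_iff_nonneg)
qed

lemma L2_space_scale:
  assumes "f \<in> L2_space d" shows "(\<lambda>i k. c * f i k) \<in> L2_space d"
proof (rule L2_spaceI)
  show "integrable unit_leb (\<lambda>i. c\<^sup>2 * (vnorm d (f i))\<^sup>2)"
    using assms by (intro integrable_mult_right L2_space_integrable_sq)
  show "(\<lambda>i. c * f i k) \<in> borel_measurable unit_leb" if "k < d" for k
    by (rule borel_measurable_times[OF borel_measurable_const L2_space_measurable[OF assms that]])
qed (simp add: vnorm_scale power_mult_distrib)

lemma L2_space_const: "(\<lambda>_. c) \<in> L2_space d"
  by (rule L2_spaceI[where g = "\<lambda>_. (vnorm d c)\<^sup>2"]) auto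

lemma L2_space_add:
  assumes "f \<in> L2_space d" "g \<in> L2_space d" shows "f + g \<in> L2_space d"
proof -
  have "f + g = f - (\<lambda>i k. (-1) * g i k)" by (auto simp: fun_eq_iff)
  then show ?thesis using L2_space_diff[OF assms(1) L2_space_scale[OF assms(2), of "-1"]] by (simp only:)
qed

lemma L2_inner_vdot: "L2_inner d f g = (LINT i|unit_leb. vdot d (f i) (g i))"
  by (simp add: L2_inner_def vdot_def)

lemma L2_inner_integrable:
  assumes "f \<in> L2_space d" "g \<in> L2_space d"
  shows "integrable unit_leb (\<lambda>i. vdot d (f i) (g i))"
proof (rule Bochner_Integration.integrable_bound)
  show "integrable unit_leb (\<lambda>i. (vnorm d (f i))\<^sup>2 + (vnorm d (g i))\<^sup>2)"
    using assms by (intro Bochner_Integration.integrable_add L2_space_integrable_sq)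
  show "(\<lambda>i. vdot d (f i) (g i)) \<in> borel_measurable unit_leb"
    using assms by (intro vdot_measurable L2_space_measurable)
qed (use abs_vdot_le_sq in \<open>auto intro!: AE_I2 order_trans[OF _ abs_ge_self]\<close>)

lemma L2_inner_commute: "L2_inner d f g = L2_inner d g f"
  by (simp add: L2_inner_vdot vdot_commute)

lemma L2_inner_diff_left:
  assumes "f \<in> L2_space d" "g \<in> L2_space d" "h \<in> L2_space d"
  shows "L2_inner d (f - g) h = L2_inner d f h - L2_inner d g h"
  using assms by (simp add: L2_inner_vdot vdot_diff_left L2_inner_integrable)

lemma L2_inner_diff_right:
  assumes "f \<in> L2_space d" "g \<in> L2_space d" "h \<in> L2_space d"
  shows "L2_inner d h (f - g) = L2_inner d h f - L2_inner d h g"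
  using L2_inner_diff_left[OF assms] by (simp add: L2_inner_commute)

lemma L2_inner_add_left:
  assumes "f \<in> L2_space d" "g \<in> L2_space d" "h \<in> L2_space d"
  shows "L2_inner d (f + g) h = L2_inner d f h + L2_inner d g h"
  using assms by (simp add: L2_inner_vdot vdot_add_left L2_inner_integrable)

lemma L2_inner_add_right:
  assumes "f \<in> L2_space d" "g \<in> L2_space d" "h \<in> L2_space d"
  shows "L2_inner d h (f + g) = L2_inner d h f + L2_inner d h g"
  using L2_inner_add_left[OF assms] by (simp only: L2_inner_commute)

lemma L2_inner_scale_left: "L2_inner d (\<lambda>i k. c * f i k) g = c * L2_inner d f g"
  by (simp add: L2_inner_vdot vdot_scale_left)

lemma L2_inner_scale_right: "L2_inner d f (\<lambda>i k. c * g i k) = c * L2_inner d f g"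
  using L2_inner_scale_left[of d c g f] by (simp add: L2_inner_commute)

lemma L2_norm_nonneg [simp]: "0 \<le> L2_norm d f"
  by (simp add: L2_norm_def)

lemma L2_norm_sq: "(L2_norm d f)\<^sup>2 = L2_inner d f f"
  by (simp add: L2_norm_def L2_inner_vdot vnorm_sq[symmetric])

lemma L2_norm_scale: "L2_norm d (\<lambda>i k. c * f i k) = \<bar>c\<bar> * L2_norm d f"
proof -
  have "(L2_norm d (\<lambda>i k. c * f i k))\<^sup>2 = (\<bar>c\<bar> * L2_norm d f)\<^sup>2"
    unfolding power_mult_distrib L2_norm_sq L2_inner_scale_left L2_inner_scale_right
    by (simp add: power2_eq_square)
  then show ?thesis by (simp add: power2_eq_iff_nonneg)
qed

lemma L2_norm_diff_sq:
  assumes "f \<in> L2_space d" "g \<in> L2_space d"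
  shows "(L2_norm d (f - g))\<^sup>2 = (L2_norm d f)\<^sup>2 - 2 * L2_inner d f g + (L2_norm d g)\<^sup>2"
  using assms unfolding L2_norm_sq
  by (simp add: L2_inner_diff_left L2_inner_diff_right L2_space_diff L2_inner_commute)

lemma L2_norm_diff_commute:
  assumes "f \<in> L2_space d" "g \<in> L2_space d"
  shows "L2_norm d (f - g) = L2_norm d (g - f)"
proof -
  have "(L2_norm d (f - g))\<^sup>2 = (L2_norm d (g - f))\<^sup>2"
    using assms by (simp add: L2_norm_diff_sq L2_inner_commute)
  then show ?thesis by (simp add: power2_eq_iff_nonneg)
qed

text \<open>The squared norm of \<open>f - c * g\<close> is a nonnegative quadratic polynomial in
  \<open>c\<close>; evaluating it at its minimum \<open>P / G\<close> gives the bound.\<close>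

lemma L2_Cauchy_Schwarz:
  assumes f: "f \<in> L2_space d" and g: "g \<in> L2_space d"
  shows "\<bar>L2_inner d f g\<bar> \<le> L2_norm d f * L2_norm d g"
proof -
  define P F G where "P = L2_inner d f g" and "F = (L2_norm d f)\<^sup>2" and "G = (L2_norm d g)\<^sup>2"
  have *: "0 \<le> F - 2 * c * P + c\<^sup>2 * G" for c
  proof -
    have "0 \<le> (L2_norm d (f - (\<lambda>i k. c * g i k)))\<^sup>2" by simp
    also have "\<dots> = F - 2 * c * P + c\<^sup>2 * G"
      unfolding L2_norm_diff_sq[OF f L2_space_scale[OF g]] L2_norm_scale L2_inner_scale_right
      by (simp add: P_def F_def G_def power_mult_distrib)
    finally show ?thesis .
  qed
  have "P\<^sup>2 \<le> F * G"
  proof (cases "G = 0")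
    case True
    have "P = 0"
    proof (rule ccontr)
      assume "P \<noteq> 0"
      \<comment> \<open>For \<open>G = 0\<close> the polynomial is affine in \<open>c\<close>, and
        at this point it takes the value -1.\<close>
      then show False using *[of "(F + 1) / (2 * P)"] True by simp
    qed
    then show ?thesis using True by simp
  next
    case False
    then have G: "0 < G" by (simp add: G_def)
    have "0 \<le> G * (F - 2 * (P / G) * P + (P / G)\<^sup>2 * G)"
      using *[of "P / G"] G by simp
    also have "\<dots> = F * G - P\<^sup>2" using G by (simp add: field_simps power2_eq_square)
    finally show ?thesis by simp
  qed
  then have "\<bar>P\<bar>\<^sup>2 \<le> (L2_norm d f * L2_norm d g)\<^sup>2"
    by (simp add: F_def G_def power_mult_distrib)
  then show ?thesis unfolding P_def by (rule power2_le_imp_le) simp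
qed

lemma L2_norm_diff_le:
  assumes f: "f \<in> L2_space d" and g: "g \<in> L2_space d"
  shows "L2_norm d (f - g) \<le> L2_norm d f + L2_norm d g"
proof (rule power2_le_imp_le)
  show "(L2_norm d (f - g))\<^sup>2 \<le> (L2_norm d f + L2_norm d g)\<^sup>2"
    using L2_Cauchy_Schwarz[OF f g] unfolding L2_norm_diff_sq[OF f g] power2_sum by auto
qed simp

lemma L2_norm_add_le:
  assumes f: "f \<in> L2_space d" and g: "g \<in> L2_space d"
  shows "L2_norm d (f + g) \<le> L2_norm d f + L2_norm d g"
proof -
  have eq: "f + g = f - (\<lambda>i k. (-1) * g i k)" by (auto simp: fun_eq_iff)
  show ?thesis
    using L2_norm_diff_le[OF f L2_space_scale[OF g, of "-1"]] unfolding eq L2_norm_scale by simp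
qed

lemma L2_norm_triangle:
  assumes "f \<in> L2_space d" "g \<in> L2_space d" "h \<in> L2_space d"
  shows "L2_norm d (f - h) \<le> L2_norm d (f - g) + L2_norm d (g - h)"
  using L2_norm_add_le[OF L2_space_diff[OF assms(1,2)] L2_space_diff[OF assms(2,3)]] by simp

section \<open>Differentiable functionals on the Hilbert space and the chain rule along
  solutions\<close>

text \<open>\<open>n g\<close> is half the gradient of \<open>\<Phi>\<close> at \<open>g\<close>, as for \<open>\<Phi> f = \<parallel>f\<parallel>\<^sup>2\<close> and \<open>n g = g\<close>.\<close>

definition smooth_functional ::
    "nat \<Rightarrow> ((real \<Rightarrow> nat \<Rightarrow> real) \<Rightarrow> real) \<Rightarrow> ((real \<Rightarrow> nat \<Rightarrow> real) \<Rightarrow> (real \<Rightarrow> nat \<Rightarrow> real)) \<Rightarrow> bool" where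
  "smooth_functional d \<Phi> n \<longleftrightarrow> (\<forall>g \<in> L2_space d. n g \<in> L2_space d) \<and>
     (\<exists>K\<ge>0. (\<forall>f \<in> L2_space d. \<forall>g \<in> L2_space d.
              \<bar>\<Phi> f - \<Phi> g - 2 * L2_inner d (n g) (f - g)\<bar> \<le> K * (L2_norm d (f - g))\<^sup>2) \<and>
            (\<forall>g \<in> L2_space d. L2_norm d (n g) \<le> K * (1 + L2_norm d g)))"

lemma smooth_functional_scale:
  assumes "smooth_functional d \<Phi> n"
  shows "smooth_functional d (\<lambda>f. c * \<Phi> f) (\<lambda>g i k. c * n g i k)"
proof -
  from assms obtain K where K: "0 \<le> K"
    "\<And>f g. f \<in> L2_space d \<Longrightarrow> g \<in> L2_space d \<Longrightarrow>
      \<bar>\<Phi> f - \<Phi> g - 2 * L2_inner d (n g) (f - g)\<bar> \<le> K * (L2_norm d (f - g))\<^sup>2"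
    "\<And>g. g \<in> L2_space d \<Longrightarrow> L2_norm d (n g) \<le> K * (1 + L2_norm d g)"
    and n: "\<And>g. g \<in> L2_space d \<Longrightarrow> n g \<in> L2_space d"
    by (auto simp: smooth_functional_def)
  have "\<bar>c * \<Phi> f - c * \<Phi> g - 2 * L2_inner d (\<lambda>i k. c * n g i k) (f - g)\<bar>
      \<le> (\<bar>c\<bar> * K) * (L2_norm d (f - g))\<^sup>2" if "f \<in> L2_space d" "g \<in> L2_space d" for f g
  proof -
    have "c * \<Phi> f - c * \<Phi> g - 2 * L2_inner d (\<lambda>i k. c * n g i k) (f - g)
        = c * (\<Phi> f - \<Phi> g - 2 * L2_inner d (n g) (f - g))"
      by (simp add: L2_inner_scale_left algebra_simps)
    then show ?thesis
      using mult_left_mono[OF K(2)[OF that] abs_ge_zero[of c]] by (simp add: abs_mult mult.assoc)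
  qed
  moreover have "L2_norm d (\<lambda>i k. c * n g i k) \<le> (\<bar>c\<bar> * K) * (1 + L2_norm d g)"
    if "g \<in> L2_space d" for g
    using mult_left_mono[OF K(3)[OF that] abs_ge_zero[of c]] by (simp add: L2_norm_scale mult.assoc)
  ultimately show ?thesis
    unfolding smooth_functional_def
    using K(1) n by (intro conjI exI[of _ "\<bar>c\<bar> * K"]) (auto simp: L2_space_scale)
qed

lemma smooth_functional_add:
  assumes "smooth_functional d \<Phi> n" "smooth_functional d \<Psi> m"
  shows "smooth_functional d (\<lambda>f. \<Phi> f + \<Psi> f) (\<lambda>g. n g + m g)"
proof -
  from assms obtain K L where K: "0 \<le> K"
    "\<And>f g. f \<in> L2_space d \<Longrightarrow> g \<in> L2_space d \<Longrightarrow>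
      \<bar>\<Phi> f - \<Phi> g - 2 * L2_inner d (n g) (f - g)\<bar> \<le> K * (L2_norm d (f - g))\<^sup>2"
    "\<And>g. g \<in> L2_space d \<Longrightarrow> L2_norm d (n g) \<le> K * (1 + L2_norm d g)"
    and n: "\<And>g. g \<in> L2_space d \<Longrightarrow> n g \<in> L2_space d"
    and L: "0 \<le> L"
    "\<And>f g. f \<in> L2_space d \<Longrightarrow> g \<in> L2_space d \<Longrightarrow>
      \<bar>\<Psi> f - \<Psi> g - 2 * L2_inner d (m g) (f - g)\<bar> \<le> L * (L2_norm d (f - g))\<^sup>2"
    "\<And>g. g \<in> L2_space d \<Longrightarrow> L2_norm d (m g) \<le> L * (1 + L2_norm d g)"
    and m: "\<And>g. g \<in> L2_space d \<Longrightarrow> m g \<in> L2_space d"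
    by (auto simp: smooth_functional_def)
  have "\<bar>(\<Phi> f + \<Psi> f) - (\<Phi> g + \<Psi> g) - 2 * L2_inner d (n g + m g) (f - g)\<bar>
      \<le> (K + L) * (L2_norm d (f - g))\<^sup>2" if "f \<in> L2_space d" "g \<in> L2_space d" for f g
    using K(2)[OF that] L(2)[OF that] that n m
    by (simp add: L2_inner_add_left L2_space_diff algebra_simps)
  moreover have "L2_norm d (n g + m g) \<le> (K + L) * (1 + L2_norm d g)"
    if "g \<in> L2_space d" for g
    using L2_norm_add_le[OF n[OF that] m[OF that]] K(3)[OF that] L(3)[OF that]
    by (simp add: algebra_simps)
  ultimately show ?thesis
    unfolding smooth_functional_def
    using K(1) L(1) n m by (intro conjI exI[of _ "K + L"]) (auto simp: L2_space_add)
qed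

text \<open>The factor 2 makes \<open>z\<close> itself half the gradient, and the first-order
  remainder is zero. A constant \<open>z\<close> yields conservation of the barycenter, a
  displacement \<open>z\<close> its size estimate.\<close>

lemma smooth_functional_inner:
  assumes "z \<in> L2_space d"
  shows "smooth_functional d (\<lambda>f. 2 * L2_inner d z f) (\<lambda>_. z)"
  unfolding smooth_functional_def
proof (intro conjI exI[of _ "L2_norm d z"] ballI)
  fix f g assume "f \<in> L2_space d" "g \<in> L2_space d"
  then show "\<bar>2 * L2_inner d z f - 2 * L2_inner d z g - 2 * L2_inner d z (f - g)\<bar>
      \<le> L2_norm d z * (L2_norm d (f - g))\<^sup>2"
    using assms by (simp add: L2_inner_diff_right)
qed (use assms in \<open>auto simp: algebra_simps\<close>)

lemma smooth_functional_sqdist: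
  assumes c: "c \<in> L2_space d"
  shows "smooth_functional d (\<lambda>f. (L2_norm d (f - c))\<^sup>2) (\<lambda>g. g - c)"
  unfolding smooth_functional_def
proof (intro conjI exI[of _ "1 + L2_norm d c"] ballI)
  fix f g assume f: "f \<in> L2_space d" and g: "g \<in> L2_space d"
  have "(L2_norm d (f - c))\<^sup>2 - (L2_norm d (g - c))\<^sup>2 - 2 * L2_inner d (g - c) (f - g)
      = (L2_norm d (f - g))\<^sup>2"
    using f g c by (simp add: L2_norm_diff_sq L2_inner_diff_left L2_inner_diff_right L2_space_diff
        L2_norm_sq L2_inner_commute)
  then show "\<bar>(L2_norm d (f - c))\<^sup>2 - (L2_norm d (g - c))\<^sup>2 - 2 * L2_inner d (g - c) (f - g)\<bar>
      \<le> (1 + L2_norm d c) * (L2_norm d (f - g))\<^sup>2"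
    by (simp add: algebra_simps)
next
  fix g assume g: "g \<in> L2_space d"
  have "L2_norm d (g - c) \<le> L2_norm d g + L2_norm d c" by (rule L2_norm_diff_le[OF g c])
  also have "\<dots> \<le> (1 + L2_norm d c) * (1 + L2_norm d g)"
    by (simp add: algebra_simps)
  finally show "L2_norm d (g - c) \<le> (1 + L2_norm d c) * (1 + L2_norm d g)" .
qed (use c in \<open>auto intro: L2_space_diff\<close>)

text \<open>Compactness by bisection: two constants on adjacent intervals combine to their maximum,
  because a detour through the common endpoint does not lengthen the path in time.\<close>

lemma Lip_loc_L2_interval:
  assumes x: "Lip_loc_L2 d x" and a: "0 \<le> a" "a \<le> b"
  shows "\<exists>C\<ge>0. \<forall>s\<in>{a..b}. \<forall>s'\<in>{a..b}. L2_norm d (x s - x s') \<le> C * \<bar>s - s'\<bar>"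
proof -
  have xL: "x t \<in> L2_space d" if "0 \<le> t" for t using x that by (auto simp: Lip_loc_L2_def)
  \<comment> \<open>Small intervals around a point may reach below 0, where nothing is known about
    \<open>x\<close>; hence the intersection with \<open>{0..}\<close>.\<close>
  define P where "P u v \<longleftrightarrow> (\<exists>C\<ge>0. \<forall>s\<in>{u..v} \<inter> {0..}. \<forall>s'\<in>{u..v} \<inter> {0..}.
      L2_norm d (x s - x s') \<le> C * \<bar>s - s'\<bar>)" for u v
  have "P a b" using a(2)
  proof (induction rule: Bolzano)
    case (trans u v w)
    from trans(1) obtain C where C: "0 \<le> C" "\<And>s s'. s\<in>{u..v} \<inter> {0..} \<Longrightarrow> s'\<in>{u..v} \<inter> {0..} \<Longrightarrow>
      L2_norm d (x s - x s') \<le> C * \<bar>s - s'\<bar>" unfolding P_def by blast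
    from trans(2) obtain D where D: "0 \<le> D" "\<And>s s'. s\<in>{v..w} \<inter> {0..} \<Longrightarrow> s'\<in>{v..w} \<inter> {0..} \<Longrightarrow>
      L2_norm d (x s - x s') \<le> D * \<bar>s - s'\<bar>" unfolding P_def by blast
    have *: "L2_norm d (x s - x s') \<le> max C D * \<bar>s - s'\<bar>"
      if s: "s \<in> {u..w}" "0 \<le> s" "s' \<in> {u..w}" "0 \<le> s'" "s \<le> s'" for s s'
    proof -
      consider "s' \<le> v" | "v \<le> s" | "s \<le> v" "v \<le> s'" by linarith
      then show ?thesis
      proof cases
        case 1
        then have "L2_norm d (x s - x s') \<le> C * \<bar>s - s'\<bar>" using C(2)[of s s'] s by auto
        also have "\<dots> \<le> max C D * \<bar>s - s'\<bar>" by (intro mult_right_mono) auto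
        finally show ?thesis .
      next
        case 2
        then have "L2_norm d (x s - x s') \<le> D * \<bar>s - s'\<bar>" using D(2)[of s s'] s by auto
        also have "\<dots> \<le> max C D * \<bar>s - s'\<bar>" by (intro mult_right_mono) auto
        finally show ?thesis .
      next
        case 3
        have "L2_norm d (x s - x s') \<le> L2_norm d (x s - x v) + L2_norm d (x v - x s')"
          using s 3 by (intro L2_norm_triangle xL) auto
        also have "\<dots> \<le> C * \<bar>s - v\<bar> + D * \<bar>v - s'\<bar>"
          using C(2)[of s v] D(2)[of v s'] s 3 by auto
        also have "\<dots> \<le> max C D * \<bar>s - v\<bar> + max C D * \<bar>v - s'\<bar>"
          by (intro add_mono mult_right_mono) auto
        also have "\<dots> = max C D * \<bar>s - s'\<bar>" using 3 by (simp add: algebra_simps)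
        finally show ?thesis .
      qed
    qed
    have "L2_norm d (x s - x s') \<le> max C D * \<bar>s - s'\<bar>"
      if s: "s \<in> {u..w} \<inter> {0..}" "s' \<in> {u..w} \<inter> {0..}" for s s'
    proof (cases "s \<le> s'")
      case False
      then show ?thesis
        using *[of s' s] s L2_norm_diff_commute[OF xL xL, of s s'] by (auto simp: abs_minus_commute)
    qed (use * s in auto)
    then show ?case unfolding P_def using C(1) by (intro exI[of _ "max C D"]) auto
  next
    case (local t)
    then have "0 \<le> t" using a by simp
    then obtain u C where u: "0 < u" and C: "\<And>s s'. s \<in> cball t u \<inter> {0..} \<Longrightarrow> s' \<in> cball t u \<inter> {0..} \<Longrightarrow>
        L2_norm d (x s - x s') \<le> C * \<bar>s - s'\<bar>" using x unfolding Lip_loc_L2_def by blast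
    show ?case
    proof (intro exI[of _ u] conjI allI impI)
      fix p q assume pq: "p \<le> t \<and> t \<le> q \<and> q - p < u"
      have "L2_norm d (x s - x s') \<le> \<bar>C\<bar> * \<bar>s - s'\<bar>"
        if s: "s \<in> {p..q} \<inter> {0..}" "s' \<in> {p..q} \<inter> {0..}" for s s'
      proof -
        have "L2_norm d (x s - x s') \<le> C * \<bar>s - s'\<bar>"
          using C[of s s'] s pq by (auto simp: dist_real_def)
        also have "\<dots> \<le> \<bar>C\<bar> * \<bar>s - s'\<bar>" by (intro mult_right_mono) auto
        finally show ?thesis .
      qed
      then show "P p q" unfolding P_def by (intro exI[of _ "\<bar>C\<bar>"]) auto
    qed (rule u)
  qed
  moreover have "{a..b} \<inter> {0..} = {a..b}" using a by auto
  ultimately show ?thesis by (simp only: P_def)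
qed

text \<open>On a compact interval the norms are bounded by \<open>B\<close>. This bounds the
  gradient by \<open>K * (1 + B)\<close>, and of the two factors in the quadratic remainder one is
  at most \<open>2 * B\<close>; the two summands of \<open>L\<close> are these
  contributions.\<close>

lemma smooth_functional_lipschitz:
  assumes x: "Lip_loc_L2 d x" and a: "0 \<le> a" "a \<le> b" and \<Phi>: "smooth_functional d \<Phi> n"
  shows "\<exists>C. C-lipschitz_on {a..b} (\<lambda>t. \<Phi> (x t))"
proof -
  have xL: "x t \<in> L2_space d" if "0 \<le> t" for t using x that by (auto simp: Lip_loc_L2_def)
  from \<Phi> obtain K where K: "0 \<le> K"
    "\<And>f g. f \<in> L2_space d \<Longrightarrow> g \<in> L2_space d \<Longrightarrow>
      \<bar>\<Phi> f - \<Phi> g - 2 * L2_inner d (n g) (f - g)\<bar> \<le> K * (L2_norm d (f - g))\<^sup>2"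
    "\<And>g. g \<in> L2_space d \<Longrightarrow> L2_norm d (n g) \<le> K * (1 + L2_norm d g)"
    and n: "\<And>g. g \<in> L2_space d \<Longrightarrow> n g \<in> L2_space d"
    by (auto simp: smooth_functional_def)
  from Lip_loc_L2_interval[OF x a] obtain C where C: "0 \<le> C"
    "\<And>s s'. s \<in> {a..b} \<Longrightarrow> s' \<in> {a..b} \<Longrightarrow> L2_norm d (x s - x s') \<le> C * \<bar>s - s'\<bar>" by blast
  define B where "B = L2_norm d (x a) + C * (b - a)"
  have B: "L2_norm d (x s) \<le> B" if "s \<in> {a..b}" for s
  proof -
    have "L2_norm d (x s) = L2_norm d (x a + (x s - x a))" by simp
    also have "\<dots> \<le> L2_norm d (x a) + L2_norm d (x s - x a)"
      using that a by (intro L2_norm_add_le L2_space_diff xL) auto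
    also have "L2_norm d (x s - x a) \<le> C * (b - a)"
      using C(2)[of s a] that a mult_left_mono[OF _ C(1), of "s - a" "b - a"] by auto
    finally show ?thesis by (simp add: B_def)
  qed
  have B0: "0 \<le> B" using order_trans[OF L2_norm_nonneg B[of a]] a by simp
  define L where "L = 2 * (K * (1 + B)) * C + K * C * (2 * B)"
  have "L-lipschitz_on {a..b} (\<lambda>t. \<Phi> (x t))"
  proof (rule lipschitz_onI)
    show "0 \<le> L" using K(1) C(1) B0 by (simp add: L_def)
    fix s s' assume s: "s \<in> {a..b}" and s': "s' \<in> {a..b}"
    have xs: "x s \<in> L2_space d" "x s' \<in> L2_space d" using s s' a xL by auto
    define e where "e = L2_norm d (x s - x s')"
    have e: "0 \<le> e" "e \<le> C * \<bar>s - s'\<bar>" "e \<le> 2 * B"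
      using C(2)[OF s s'] L2_norm_diff_le[OF xs] B[OF s] B[OF s'] by (auto simp: e_def)
    have "\<bar>L2_inner d (n (x s')) (x s - x s')\<bar> \<le> L2_norm d (n (x s')) * e"
      unfolding e_def using xs by (intro L2_Cauchy_Schwarz n L2_space_diff)
    also have "\<dots> \<le> (K * (1 + B)) * e"
      using K(3)[OF xs(2)] B[OF s'] K(1) e(1)
      by (intro mult_right_mono) (auto intro: order_trans[OF _ mult_left_mono])
    finally have 1: "\<bar>L2_inner d (n (x s')) (x s - x s')\<bar> \<le> (K * (1 + B)) * e" .
    have "K * e\<^sup>2 \<le> K * (2 * B * e)"
      using e K(1) by (intro mult_left_mono) (auto simp: power2_eq_square intro: mult_right_mono)
    then have "\<bar>\<Phi> (x s) - \<Phi> (x s')\<bar> \<le> 2 * ((K * (1 + B)) * e) + K * (2 * B * e)"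
      using K(2)[OF xs] 1 unfolding e_def[symmetric] by linarith
    also have "\<dots> = (2 * (K * (1 + B)) + K * (2 * B)) * e" by (simp add: algebra_simps)
    also have "\<dots> \<le> (2 * (K * (1 + B)) + K * (2 * B)) * (C * \<bar>s - s'\<bar>)"
      using e(2) K(1) B0 by (intro mult_left_mono) auto
    also have "\<dots> = L * \<bar>s - s'\<bar>" by (simp add: L_def algebra_simps)
    finally show "dist (\<Phi> (x s)) (\<Phi> (x s')) \<le> L * dist s s'" by (simp add: dist_real_def)
  qed
  then show ?thesis by blast
qed

text \<open>The chain rule, with the quadratic remainder divided by \<open>s - t\<close> tending to
  0. Time 0 is excluded because the conclusion is a two-sided derivative, while
  \<open>has_L2_derivative\<close> is taken within \<open>{0..}\<close>.\<close>

lemma smooth_functional_derivative: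
  assumes xL: "\<And>t. 0 \<le> t \<Longrightarrow> x t \<in> L2_space d" and t: "0 < t"
    and \<Phi>: "smooth_functional d \<Phi> n" and der: "has_L2_derivative d x y t"
  shows "((\<lambda>s. \<Phi> (x s)) has_real_derivative 2 * L2_inner d (n (x t)) y) (at t)"
proof -
  from \<Phi> obtain K where K: "0 \<le> K"
    "\<And>f g. f \<in> L2_space d \<Longrightarrow> g \<in> L2_space d \<Longrightarrow>
      \<bar>\<Phi> f - \<Phi> g - 2 * L2_inner d (n g) (f - g)\<bar> \<le> K * (L2_norm d (f - g))\<^sup>2"
    and n: "\<And>g. g \<in> L2_space d \<Longrightarrow> n g \<in> L2_space d"
    unfolding smooth_functional_def by blast
  have y: "y \<in> L2_space d" using der by (simp add: has_L2_derivative_def)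
  \<comment> \<open>The error of the difference quotient. The displacement is then exactly
    \<open>(s - t) * (q s + y)\<close>, which separates the limit from what vanishes.\<close>
  define q where "q s = (\<lambda>i k. (x s i k - x t i k) / (s - t) - y i k)" for s
  have "at t within {0..} = at t" using t by (intro at_within_interior) auto
  then have q0: "((\<lambda>s. L2_norm d (q s)) \<longlongrightarrow> 0) (at t)"
    using der by (simp add: has_L2_derivative_def q_def)
  define N where "N = L2_norm d (n (x t))"
  have lim: "((\<lambda>s. 2 * N * L2_norm d (q s) + K * \<bar>s - t\<bar> * (L2_norm d (q s) + L2_norm d y)\<^sup>2) \<longlongrightarrow> 0) (at t)"
  proof -
    have "((\<lambda>s. 2 * N * L2_norm d (q s) + K * \<bar>s - t\<bar> * (L2_norm d (q s) + L2_norm d y)\<^sup>2)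
        \<longlongrightarrow> 2 * N * 0 + K * \<bar>t - t\<bar> * (0 + L2_norm d y)\<^sup>2) (at t)"
      by (intro tendsto_intros q0)
    then show ?thesis by simp
  qed
  have ev: "\<forall>\<^sub>F s in at t. norm ((\<Phi> (x s) - \<Phi> (x t)) / (s - t) - 2 * L2_inner d (n (x t)) y)
      \<le> 2 * N * L2_norm d (q s) + K * \<bar>s - t\<bar> * (L2_norm d (q s) + L2_norm d y)\<^sup>2"
  proof -
    have "\<forall>\<^sub>F s in at t. s \<in> {0<..} \<and> s \<noteq> t"
      using t by (intro eventually_conj eventually_at_in_open' eventually_neq_at_within)
        (auto simp: eventually_at_filter)
    then show ?thesis
    proof eventually_elim
      case (elim s)
      then have s: "0 \<le> s" "s \<noteq> t" by auto
      have xs: "x s \<in> L2_space d" "x t \<in> L2_space d" using s t xL by auto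
      have qe: "q s = (\<lambda>i k. (1 / (s - t)) * (x s - x t) i k) - y"
        by (auto simp: q_def fun_eq_iff)
      have dL: "(\<lambda>i k. (1 / (s - t)) * (x s - x t) i k) \<in> L2_space d"
        using xs by (intro L2_space_scale L2_space_diff)
      have qL: "q s \<in> L2_space d" unfolding qe by (intro L2_space_diff dL y)
      have dq: "x s - x t = (\<lambda>i k. (s - t) * (q s + y) i k)"
        using s by (auto simp: q_def fun_eq_iff)
      have "L2_norm d (x s - x t) = \<bar>s - t\<bar> * L2_norm d (q s + y)"
        unfolding dq by (rule L2_norm_scale)
      also have "\<dots> \<le> \<bar>s - t\<bar> * (L2_norm d (q s) + L2_norm d y)"
        by (intro mult_left_mono L2_norm_add_le qL y) auto
      finally have "(L2_norm d (x s - x t))\<^sup>2 \<le> (\<bar>s - t\<bar> * (L2_norm d (q s) + L2_norm d y))\<^sup>2"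
        by (intro power_mono) auto
      then have r: "\<bar>\<Phi> (x s) - \<Phi> (x t) - 2 * L2_inner d (n (x t)) (x s - x t)\<bar>
          \<le> K * (\<bar>s - t\<bar> * (L2_norm d (q s) + L2_norm d y))\<^sup>2"
        using K(2)[OF xs] mult_left_mono[OF _ K(1)] order_trans by blast
      have i: "L2_inner d (n (x t)) (x s - x t) = (s - t) * (L2_inner d (n (x t)) (q s) + L2_inner d (n (x t)) y)"
        unfolding dq by (subst L2_inner_scale_right) (simp only: L2_inner_add_right[OF qL y n[OF xs(2)]])
      define r' where "r' = \<Phi> (x s) - \<Phi> (x t) - 2 * L2_inner d (n (x t)) (x s - x t)"
      have "(\<Phi> (x s) - \<Phi> (x t)) / (s - t) - 2 * L2_inner d (n (x t)) y
          = 2 * L2_inner d (n (x t)) (q s) + r' / (s - t)"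
        using s unfolding r'_def i by (simp add: field_simps)
      moreover have "\<bar>L2_inner d (n (x t)) (q s)\<bar> \<le> N * L2_norm d (q s)"
        unfolding N_def by (intro L2_Cauchy_Schwarz n xs qL)
      moreover have "\<bar>r' / (s - t)\<bar> \<le> K * \<bar>s - t\<bar> * (L2_norm d (q s) + L2_norm d y)\<^sup>2"
        using r s unfolding r'_def[symmetric] abs_divide
        by (subst pos_divide_le_eq) (auto simp: power_mult_distrib power2_eq_square algebra_simps)
      ultimately show ?case unfolding real_norm_def by linarith
    qed
  qed
  have "((\<lambda>s. (\<Phi> (x s) - \<Phi> (x t)) / (s - t) - 2 * L2_inner d (n (x t)) y) \<longlongrightarrow> 0) (at t)"
    by (rule Lim_null_comparison[OF ev lim])
  then show ?thesis unfolding has_field_derivative_iff by (rule LIM_zero_cancel)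
qed

lemma AE_lebesgue_on_Icc:
  fixes a b :: real
  assumes "AE t in lebesgue_on {0..}. P t" and "0 \<le> a"
  shows "AE t in lebesgue_on {a..b}. 0 < t \<and> P t"
proof -
  have "AE t in lebesgue. t \<in> {0..} \<longrightarrow> P t"
    using assms(1) by (subst (asm) AE_restrict_space_iff) auto
  moreover have "AE t in lebesgue. t \<noteq> (0::real)"
    using AE_lborel_singleton[of "0::real"] by (simp add: AE_completion_iff)
  ultimately have "AE t in lebesgue. t \<in> {a..b} \<longrightarrow> 0 < t \<and> P t"
    by eventually_elim (use assms(2) in auto)
  then show ?thesis by (subst AE_restrict_space_iff) auto
qed

text \<open>The access to the equation for all later estimates. Only lower bounds are needed: an
  upper bound on a functional is obtained by applying this to its negative.\<close>

lemma smooth_functional_integral_le: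
  assumes x: "graphon_solution d a \<phi> x0 x" and \<Phi>: "smooth_functional d \<Phi> n"
    and s: "0 \<le> s" "s \<le> t"
    and A: "integrable (lebesgue_on {s..t}) A"
    and le: "AE r in lebesgue_on {s..t}. A r \<le> 2 * L2_inner d (n (x r)) (graphon_field d a \<phi> r (x r))"
  shows "(LINT r|lebesgue_on {s..t}. A r) \<le> \<Phi> (x t) - \<Phi> (x s)"
proof -
  have xl: "Lip_loc_L2 d x" using x by (simp add: graphon_solution_def)
  then have xL: "\<And>r. 0 \<le> r \<Longrightarrow> x r \<in> L2_space d" by (simp add: Lip_loc_L2_def)
  obtain C where C: "C-lipschitz_on {s..t} (\<lambda>r. \<Phi> (x r))"
    using smooth_functional_lipschitz[OF xl s \<Phi>] by blast
  have "AE r in lebesgue_on {0..}. has_L2_derivative d x (graphon_field d a \<phi> r (x r)) r"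
    using x by (simp add: graphon_solution_def)
  from AE_lebesgue_on_Icc[OF this s(1)] le
  have "AE r in lebesgue_on {s..t}. \<exists>D. ((\<lambda>r. \<Phi> (x r)) has_real_derivative D) (at r) \<and> A r \<le> D"
  proof eventually_elim
    case (elim r)
    then have "0 < r" and der: "has_L2_derivative d x (graphon_field d a \<phi> r (x r)) r" by auto
    from smooth_functional_derivative[OF xL this(1) \<Phi> der] elim(2) show ?case by (intro exI conjI)
  qed
  then show ?thesis by (rule lipschitz_integral_le[OF s(2) C A])
qed

section \<open>Weighted graph fields and measurable kernels\<close>

interpretation unit_leb: prob_space unit_leb
  by (rule prob_spaceI) (simp add: emeasure_restrict_space)

interpretation unit_sq: pair_prob_space unit_leb unit_leb ..

abbreviation unit_sq :: "(real \<times> real) measure" where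
  "unit_sq \<equiv> unit_leb \<Otimes>\<^sub>M unit_leb"

lemma integrable_unit_sq_fst:
  fixes f :: "real \<Rightarrow> real"
  assumes "integrable unit_leb f" shows "integrable unit_sq (\<lambda>p. f (fst p))"
  using integrable_distr[of fst unit_sq unit_leb f] assms by (simp add: unit_leb.distr_pair_fst)

lemma integral_unit_sq_fst:
  fixes f :: "real \<Rightarrow> real"
  assumes "integrable unit_leb f" shows "(LINT p|unit_sq. f (fst p)) = (LINT i|unit_leb. f i)"
  using integral_distr[of fst unit_sq unit_leb f] assms by (simp add: unit_leb.distr_pair_fst)

lemma integrable_unit_sq_swap:
  fixes f :: "real \<times> real \<Rightarrow> real"
  assumes "integrable unit_sq f" shows "integrable unit_sq (\<lambda>p. f (snd p, fst p))"
  using unit_sq.integrable_product_swap[OF assms] by (simp add: case_prod_unfold)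

lemma integral_unit_sq_swap:
  fixes f :: "real \<times> real \<Rightarrow> real"
  assumes "integrable unit_sq f" shows "(LINT p|unit_sq. f (snd p, fst p)) = (LINT p|unit_sq. f p)"
  using unit_sq.integral_product_swap[of f] assms by (simp add: case_prod_unfold)

lemma integrable_unit_sq_snd:
  fixes f :: "real \<Rightarrow> real"
  assumes "integrable unit_leb f" shows "integrable unit_sq (\<lambda>p. f (snd p))"
  using integrable_unit_sq_swap[OF integrable_unit_sq_fst[OF assms]] by simp

lemma integral_unit_sq_snd:
  fixes f :: "real \<Rightarrow> real"
  assumes "integrable unit_leb f" shows "(LINT p|unit_sq. f (snd p)) = (LINT i|unit_leb. f i)"
  using integral_unit_sq_swap[OF integrable_unit_sq_fst[OF assms]] integral_unit_sq_fst[OF assms] by simp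

lemma L2_space_measurable_fst: "f \<in> L2_space d \<Longrightarrow> k < d \<Longrightarrow> (\<lambda>p. f (fst p) k) \<in> borel_measurable unit_sq"
  by (rule measurable_compose[OF measurable_fst L2_space_measurable])

lemma L2_space_measurable_snd: "f \<in> L2_space d \<Longrightarrow> k < d \<Longrightarrow> (\<lambda>p. f (snd p) k) \<in> borel_measurable unit_sq"
  by (rule measurable_compose[OF measurable_snd L2_space_measurable])

lemma L2_space_measurable_diff:
  "f \<in> L2_space d \<Longrightarrow> k < d \<Longrightarrow> (\<lambda>p. (f (fst p) - f (snd p)) k) \<in> borel_measurable unit_sq"
  using L2_space_measurable_fst L2_space_measurable_snd by simp

lemma integrable_vnorm_diff_sq:
  assumes f: "f \<in> L2_space d"
  shows "integrable unit_sq (\<lambda>p. (vnorm d (f (fst p) - f (snd p)))\<^sup>2)"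
proof (rule Bochner_Integration.integrable_bound)
  show "integrable unit_sq (\<lambda>p. 2 * (vnorm d (f (fst p)))\<^sup>2 + 2 * (vnorm d (f (snd p)))\<^sup>2)"
    using integrable_unit_sq_fst[OF L2_space_integrable_sq[OF f]]
      integrable_unit_sq_snd[OF L2_space_integrable_sq[OF f]] by simp
  show "(\<lambda>p. (vnorm d (f (fst p) - f (snd p)))\<^sup>2) \<in> borel_measurable unit_sq"
    by (intro borel_measurable_power vnorm_measurable) (rule L2_space_measurable_diff[OF f])
qed (use vnorm_diff_sq_le in \<open>auto intro!: AE_I2 order_trans[OF _ abs_ge_self]\<close>)

lemma integral_vnorm_diff_sq_le:
  assumes f: "f \<in> L2_space d"
  shows "(LINT p|unit_sq. (vnorm d (f (fst p) - f (snd p)))\<^sup>2) \<le> 4 * (L2_norm d f)\<^sup>2"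
proof -
  note i = L2_space_integrable_sq[OF f]
  have "(LINT p|unit_sq. (vnorm d (f (fst p) - f (snd p)))\<^sup>2)
      \<le> (LINT p|unit_sq. 2 * (vnorm d (f (fst p)))\<^sup>2 + 2 * (vnorm d (f (snd p)))\<^sup>2)"
    by (intro integral_mono integrable_vnorm_diff_sq f vnorm_diff_sq_le)
      (use integrable_unit_sq_fst[OF i] integrable_unit_sq_snd[OF i] in simp)
  also have "\<dots> = 4 * (LINT i|unit_leb. (vnorm d (f i))\<^sup>2)"
    using integrable_unit_sq_fst[OF i] integrable_unit_sq_snd[OF i]
      integral_unit_sq_fst[OF i] integral_unit_sq_snd[OF i] by simp
  also have "\<dots> = 4 * (L2_norm d f)\<^sup>2"
    unfolding L2_norm_sq L2_inner_vdot vnorm_sq ..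
  finally show ?thesis .
qed

lemma integrable_weighted:
  fixes w F G :: "real \<times> real \<Rightarrow> real"
  assumes "w \<in> borel_measurable unit_sq" "F \<in> borel_measurable unit_sq" "integrable unit_sq G"
    and "\<And>p. \<bar>w p\<bar> \<le> K" "\<And>p. \<bar>F p\<bar> \<le> G p"
  shows "integrable unit_sq (\<lambda>p. w p * F p)"
proof (rule Bochner_Integration.integrable_bound)
  show "integrable unit_sq (\<lambda>p. K * G p)" using assms by simp
  have "\<bar>w p\<bar> * \<bar>F p\<bar> \<le> K * G p" for p
    using assms(4,5)[of p] by (intro mult_mono order_trans[OF abs_ge_zero assms(4)]) auto
  then have "norm (w p * F p) \<le> norm (K * G p)" for p
    unfolding real_norm_def abs_mult[of "w p"] by (rule order_trans[OF _ abs_ge_self])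
  then show "AE p in unit_sq. norm (w p * F p) \<le> norm (K * G p)"
    by (rule AE_I2)
qed (use assms in simp)

lemma integrable_weighted_vdot:
  assumes "w \<in> borel_measurable unit_sq" "\<And>p. \<bar>w p\<bar> \<le> K" "z \<in> L2_space d" "y \<in> L2_space d"
  shows "integrable unit_sq (\<lambda>p. w p * vdot d (z (fst p) - z (snd p)) (y (fst p) - y (snd p)))"
proof (rule integrable_weighted[OF assms(1) _ _ assms(2)])
  show "(\<lambda>p. vdot d (z (fst p) - z (snd p)) (y (fst p) - y (snd p))) \<in> borel_measurable unit_sq"
    by (intro vdot_measurable) (rule L2_space_measurable_diff[OF assms(3)] L2_space_measurable_diff[OF assms(4)], assumption)+
  show "integrable unit_sq (\<lambda>p. (vnorm d (z (fst p) - z (snd p)))\<^sup>2 + (vnorm d (y (fst p) - y (snd p)))\<^sup>2)"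
    by (intro Bochner_Integration.integrable_add integrable_vnorm_diff_sq assms)
qed (rule abs_vdot_le_sq)

lemma weighted_field_measurable:
  assumes w: "(\<lambda>p. w (fst p) (snd p)) \<in> borel_measurable unit_sq" and y: "y \<in> L2_space d" and k: "k < d"
  shows "(\<lambda>i. LINT j|unit_leb. w i j * (y j k - y i k)) \<in> borel_measurable unit_leb"
proof (rule unit_leb.borel_measurable_lebesgue_integral)
  have "(\<lambda>p. w (fst p) (snd p) * (y (snd p) k - y (fst p) k)) \<in> borel_measurable unit_sq"
    by (intro borel_measurable_times borel_measurable_diff w L2_space_measurable_fst[OF y k] L2_space_measurable_snd[OF y k])
  then show "(\<lambda>(i, j). w i j * (y j k - y i k)) \<in> borel_measurable unit_sq"
    by (simp add: case_prod_unfold)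
qed

text \<open>The pairing is a double integral of \<open>Q\<close>; averaging it with its image under
  exchange of the variables leaves minus half a Dirichlet form. Since \<open>w\<close> is any
  bounded measurable symmetric kernel, the identity serves both the averaged Laplacian and, with
  \<open>\<phi>\<close> absorbed into \<open>w\<close>, the nonlinear field.\<close>

lemma L2_inner_weighted_field:
  assumes w: "(\<lambda>p. w (fst p) (snd p)) \<in> borel_measurable unit_sq" and b: "\<And>i j. \<bar>w i j\<bar> \<le> K"
    and sym: "\<And>i j. w i j = w j i"
    and z: "z \<in> L2_space d" and y: "y \<in> L2_space d"
  shows "L2_inner d z (\<lambda>i k. LINT j|unit_leb. w i j * (y j k - y i k))
    = - (1 / 2) * (LINT p|unit_sq. w (fst p) (snd p) * vdot d (z (fst p) - z (snd p)) (y (fst p) - y (snd p)))"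
proof -
  define Q where "Q p = w (fst p) (snd p) * vdot d (z (fst p)) (y (snd p) - y (fst p))" for p
  have Q: "integrable unit_sq Q"
    unfolding Q_def
  proof (rule integrable_weighted[OF w _ _ b])
    show "(\<lambda>p. vdot d (z (fst p)) (y (snd p) - y (fst p))) \<in> borel_measurable unit_sq"
      by (intro vdot_measurable L2_space_measurable_fst[OF z])
        (use L2_space_measurable_fst[OF y] L2_space_measurable_snd[OF y] in simp_all)
    show "integrable unit_sq (\<lambda>p. (vnorm d (z (fst p)))\<^sup>2 + (vnorm d (y (fst p) - y (snd p)))\<^sup>2)"
      by (intro Bochner_Integration.integrable_add integrable_vnorm_diff_sq y
          integrable_unit_sq_fst[OF L2_space_integrable_sq] z)
    show "\<bar>vdot d (z (fst p)) (y (snd p) - y (fst p))\<bar> \<le> (vnorm d (z (fst p)))\<^sup>2 + (vnorm d (y (fst p) - y (snd p)))\<^sup>2" for p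
      using abs_vdot_le_sq[of d "z (fst p)" "y (snd p) - y (fst p)"] vnorm_diff_commute[of d "y (fst p)" "y (snd p)"]
      by simp
  qed
  have inner: "(\<Sum>k<d. z i k * (LINT j|unit_leb. w i j * (y j k - y i k))) = (LINT j|unit_leb. Q (i, j))"
    if "i \<in> space unit_leb" for i
  proof -
    have wi: "(\<lambda>j. w i j) \<in> borel_measurable unit_leb"
      using measurable_compose[OF measurable_Pair1'[OF that] w] by simp
    have int: "integrable unit_leb (\<lambda>j. w i j * (y j k - y i k))" if "k < d" for k
    proof (rule Bochner_Integration.integrable_bound)
      have yk: "integrable unit_leb (\<lambda>j. y j k - y i k)"
        using L2_space_component_integrable[OF y that] by simp
      then show "integrable unit_leb (\<lambda>j. K * (y j k - y i k))" by simp
      show "(\<lambda>j. w i j * (y j k - y i k)) \<in> borel_measurable unit_leb"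
        using wi yk by simp
      show "AE j in unit_leb. norm (w i j * (y j k - y i k)) \<le> norm (K * (y j k - y i k))"
        using b by (intro AE_I2) (auto simp: abs_mult intro!: mult_right_mono intro: order_trans[OF _ abs_ge_self])
    qed
    have "(\<Sum>k<d. z i k * (LINT j|unit_leb. w i j * (y j k - y i k)))
        = (LINT j|unit_leb. (\<Sum>k<d. z i k * (w i j * (y j k - y i k))))"
      using int by (simp add: Bochner_Integration.integral_sum)
    also have "\<dots> = (LINT j|unit_leb. Q (i, j))"
      by (simp add: Q_def vdot_def sum_distrib_left mult_ac)
    finally show ?thesis .
  qed
  have "L2_inner d z (\<lambda>i k. LINT j|unit_leb. w i j * (y j k - y i k)) = (LINT i|unit_leb. LINT j|unit_leb. Q (i, j))"
    unfolding L2_inner_def by (rule Bochner_Integration.integral_cong[OF refl inner])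
  also have "\<dots> = (LINT p|unit_sq. Q p)"
    by (rule unit_sq.integral_fst'[OF Q])
  finally have *: "L2_inner d z (\<lambda>i k. LINT j|unit_leb. w i j * (y j k - y i k)) = (LINT p|unit_sq. Q p)" .
  have "(LINT p|unit_sq. w (fst p) (snd p) * vdot d (z (fst p) - z (snd p)) (y (fst p) - y (snd p)))
      = (LINT p|unit_sq. - (Q p + Q (snd p, fst p)))"
  proof (intro Bochner_Integration.integral_cong refl)
    fix p show "w (fst p) (snd p) * vdot d (z (fst p) - z (snd p)) (y (fst p) - y (snd p)) = - (Q p + Q (snd p, fst p))"
      using sym[of "fst p" "snd p"] by (simp add: Q_def vdot_diff_left vdot_diff_right algebra_simps)
  qed
  also have "\<dots> = - (2 * (LINT p|unit_sq. Q p))"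
    using Q integrable_unit_sq_swap[OF Q] integral_unit_sq_swap[OF Q] by simp
  finally show ?thesis using * by simp
qed

section \<open>Null sets, and Borel versions of Lebesgue measurable kernels\<close>

lemma AE_lebesgue_onI:
  assumes "AE x in lborel. x \<in> S \<longrightarrow> P x" "S \<in> sets lebesgue"
  shows "AE x in lebesgue_on S. P x"
  using assms by (subst AE_restrict_space_iff) (auto simp: AE_completion_iff)

lemma AE_lebesgue_onD:
  assumes "AE x in lebesgue_on S. P x" "S \<in> sets lebesgue"
  shows "AE x in lborel. x \<in> S \<longrightarrow> P x"
  using assms by (subst (asm) AE_restrict_space_iff) (auto simp: AE_completion_iff)

text \<open>Lebesgue measure is complete, so \<open>f\<close> inherits measurability from
  \<open>g\<close>. This allows \<open>a\<close> to be replaced by \<open>b\<close> inside integrals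
  without knowing that the sections of \<open>a\<close> are measurable.\<close>

lemma lebesgue_on_integral_cong_AE:
  fixes f g :: "'a::euclidean_space \<Rightarrow> real"
  assumes S: "S \<in> sets lebesgue" and g: "g \<in> borel_measurable (lebesgue_on S)"
    and eq: "AE x in lebesgue_on S. f x = g x"
  shows "(LINT x|lebesgue_on S. f x) = (LINT x|lebesgue_on S. g x)"
proof (rule integral_cong_AE[OF _ g eq])
  have "(\<lambda>x. if x \<in> S then g x else 0) \<in> borel_measurable lebesgue"
    using g S by (simp add: borel_measurable_if)
  moreover have "AE x in lebesgue. (if x \<in> S then g x else 0) = (if x \<in> S then f x else 0)"
    using AE_lebesgue_onD[OF eq S] by (auto simp: AE_completion_iff)
  ultimately have "(\<lambda>x. if x \<in> S then f x else 0) \<in> borel_measurable lebesgue"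
    by (rule borel_measurable_AE)
  then show "f \<in> borel_measurable (lebesgue_on S)"
    using S by (simp add: borel_measurable_if)
qed

lemma AE_lborel_swap:
  assumes "AE p in (lborel :: ('a::euclidean_space \<times> 'b::euclidean_space) measure). P p"
  shows "AE p in (lborel :: ('b \<times> 'a) measure). P (snd p, fst p)"
proof -
  have "AE p in distr (lborel \<Otimes>\<^sub>M lborel) (lborel \<Otimes>\<^sub>M lborel) (\<lambda>(x, y). (y, x)). P p"
    using assms unfolding lborel_pair.distr_pair_swap[symmetric] unfolding lborel_prod .
  from AE_distrD[OF measurable_pair_swap' this]
  have "AE p in (lborel \<Otimes>\<^sub>M lborel :: ('b \<times> 'a) measure). P (case p of (x, y) \<Rightarrow> (y, x))" .
  then show ?thesis unfolding lborel_prod case_prod_unfold .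
qed

lemma AE_lborel_pair:
  assumes "AE p in (lborel :: ('a::euclidean_space \<times> 'b::euclidean_space) measure). P p"
  shows "AE x in lborel. AE y in lborel. P (x, y)"
  using assms by (intro lborel_pair.AE_pair) (unfold lborel_prod)

text \<open>
  \<open>a = b\<close> is recorded for both orders of the variables, because \<open>a\<close> is only Lebesgue measurable and
  Fubini's theorem for product measures applies to \<open>b\<close> alone.
\<close>

locale kernel_version =
  fixes a b :: "real \<Rightarrow> real \<Rightarrow> real \<Rightarrow> real"
  assumes b_borel: "(\<lambda>p. b (fst p) (fst (snd p)) (snd (snd p))) \<in> borel_measurable (borel :: (real \<times> real \<times> real) measure)"
    and b_sym: "\<And>t i j. b t i j = b t j i"
    and b_nonneg: "\<And>t i j. 0 \<le> b t i j" and b_le_1: "\<And>t i j. b t i j \<le> 1"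
    and a_eq_b: "AE t in lebesgue_on {0..}. AE i in unit_leb. AE j in unit_leb. a t i j = b t i j"
    and a_eq_b': "AE i in unit_leb. AE t in lebesgue_on {0..}. AE j in unit_leb. a t i j = b t i j"

text \<open>Extended by zero, \<open>a\<close> agrees almost everywhere with a Borel function
  \<open>b0\<close>. Averaging over the exchange of the two space variables and clipping to [0,1]
  make symmetry and bounds hold everywhere, and change \<open>b0\<close> only on a null set inside
  \<open>S\<close>.\<close>

lemma kernel_version_exists:
  assumes a: "measurable_kernel a" and sym: "symmetric_kernel a"
  shows "\<exists>b. kernel_version a b"
proof -
  define S :: "(real \<times> real \<times> real) set" where "S = {0..} \<times> {0..1} \<times> {0..1}"
  have Sb[measurable]: "S \<in> sets borel" unfolding S_def by (intro borel_closed closed_Times) auto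
  define a0 where "a0 p = (if p \<in> S then a (fst p) (fst (snd p)) (snd (snd p)) else 0)" for p
  have "(\<lambda>p. a (fst p) (fst (snd p)) (snd (snd p))) \<in> borel_measurable (lebesgue_on S)"
    using a by (simp add: measurable_kernel_def S_def case_prod_unfold)
  then have "a0 \<in> borel_measurable lebesgue"
    unfolding a0_def using borel_measurable_if[of S "\<lambda>p. a (fst p) (fst (snd p)) (snd (snd p))"] by simp
  then obtain b0 where "b0 \<in> borel_measurable lborel" and ab: "AE p in lborel. a0 p = b0 p"
    using completion_ex_borel_measurable_real by blast
  then have b0[measurable]: "b0 \<in> borel_measurable borel" by simp
  define \<sigma> :: "real \<times> real \<times> real \<Rightarrow> real \<times> real \<times> real" where "\<sigma> p = (fst p, snd (snd p), fst (snd p))" for p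
  have \<sigma>[measurable]: "\<sigma> \<in> borel_measurable borel"
    unfolding \<sigma>_def by (intro borel_measurable_continuous_onI continuous_intros)
  \<comment> \<open>Symmetry is assumed on time slices, and null slices make a null set only when
    that set is measurable. So the symmetry is moved to \<open>b0\<close> slice by slice, and the
    slices are put together afterwards.\<close>
  have symb: "AE p in lborel. p \<in> S \<longrightarrow> b0 p = b0 (\<sigma> p)"
  proof -
    have "AE t in lborel. t \<in> {0..} \<longrightarrow> (AE (i, j) in lebesgue_on ({0..1} \<times> {0..1}). a t i j = a t j i)"
      using AE_lebesgue_onD[OF sym[unfolded symmetric_kernel_def]] by simp
    with AE_lborel_pair[OF ab]
    have "AE t in lborel. AE q in lborel. (t, q) \<in> S \<longrightarrow> b0 (t, q) = b0 (\<sigma> (t, q))"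
    proof eventually_elim
      case (elim t)
      show ?case
      proof (cases "0 \<le> t")
        case True
        have "({0..1} \<times> {0..1} :: (real \<times> real) set) \<in> sets lebesgue"
          by (intro borel_closed[THEN sets_completionI_sets[of _ lborel, simplified]] closed_Times) auto
        with elim(2) True have "AE q in lborel. q \<in> {0..1} \<times> {0..1} \<longrightarrow> a t (fst q) (snd q) = a t (snd q) (fst q)"
          by (intro AE_lebesgue_onD) (auto simp: case_prod_unfold)
        with elim(1) AE_lborel_swap[OF elim(1)] show ?thesis
        proof eventually_elim
          case (elim q)
          then show ?case by (cases q) (auto simp: S_def a0_def \<sigma>_def)
        qed
      qed (auto simp: S_def)
    qed
    moreover have "{p \<in> space borel. p \<in> S \<longrightarrow> b0 p = b0 (\<sigma> p)} \<in> sets borel"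
      by measurable
    ultimately have "AE p in lborel \<Otimes>\<^sub>M lborel. p \<in> S \<longrightarrow> b0 p = b0 (\<sigma> p)"
      by (intro lborel_pair.AE_pair_measure) (simp_all only: lborel_prod sets_lborel space_lborel space_borel)
    then show ?thesis unfolding lborel_prod .
  qed
  define b where "b t i j = max 0 (min 1 ((b0 (t, i, j) + b0 (t, j, i)) / 2))" for t i j
  have "AE p in lborel. p \<in> S \<longrightarrow> a0 p = b (fst p) (fst (snd p)) (snd (snd p))"
    using ab symb
  proof eventually_elim
    case (elim p)
    show ?case
    proof
      assume p: "p \<in> S"
      then have "a0 p \<in> {0..1}" using a by (auto simp: a0_def measurable_kernel_def S_def)
      with p elim show "a0 p = b (fst p) (fst (snd p)) (snd (snd p))"
        by (auto simp: b_def \<sigma>_def)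
    qed
  qed
  \<comment> \<open>The exceptional set involves \<open>a\<close>, so it is covered by a Borel null
    set, whose sections are Borel in every order of the variables.\<close>
  then obtain N where N: "{p \<in> space lborel. \<not> (p \<in> S \<longrightarrow> a0 p = b (fst p) (fst (snd p)) (snd (snd p)))} \<subseteq> N"
      "N \<in> null_sets lborel" by (auto elim: AE_E3 simp: eventually_ae_filter)
  have Nb[measurable]: "N \<in> sets borel" using N(2) by (auto simp: null_sets_def)
  have N': "AE p in lborel. p \<notin> N" using N(2) by (rule AE_not_in)
  have eq: "a t i j = b t i j" if "t \<ge> 0" "i \<in> {0..1}" "j \<in> {0..1}" "(t, i, j) \<notin> N" for t i j
    using subsetD[OF N(1), of "(t, i, j)"] that by (auto simp: S_def a0_def)
  have 1: "AE t in lebesgue_on {0..}. AE i in unit_leb. AE j in unit_leb. a t i j = b t i j"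
  proof (rule AE_lebesgue_onI)
    show "AE t in lborel. t \<in> {0..} \<longrightarrow> (AE i in unit_leb. AE j in unit_leb. a t i j = b t i j)"
      using AE_lborel_pair[OF N']
    proof eventually_elim
      case (elim t)
      show ?case
      proof
        assume t: "t \<in> {0..}"
        show "AE i in unit_leb. AE j in unit_leb. a t i j = b t i j"
        proof (rule AE_lebesgue_onI)
          show "AE i in lborel. i \<in> {0..1} \<longrightarrow> (AE j in unit_leb. a t i j = b t i j)"
            using AE_lborel_pair[OF elim]
            by eventually_elim (use t eq in \<open>auto intro!: AE_lebesgue_onI elim!: eventually_mono\<close>)
        qed simp
      qed
    qed
  qed simp
  have 2: "AE i in unit_leb. AE t in lebesgue_on {0..}. AE j in unit_leb. a t i j = b t i j"
  proof (rule AE_lebesgue_onI)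
    show "AE i in lborel. i \<in> {0..1} \<longrightarrow> (AE t in lebesgue_on {0..}. AE j in unit_leb. a t i j = b t i j)"
      \<comment> \<open>Moving time to the end gives the order \<open>i\<close>, \<open>j\<close>,
        \<open>t\<close>. For fixed \<open>i\<close>, the Borel section of \<open>N\<close> is null
        in the plane, and this exchanges \<open>j\<close> and \<open>t\<close>.\<close>
      using AE_lborel_pair[OF AE_lborel_pair[OF AE_lborel_swap[OF N']]]
    proof eventually_elim
      case (elim i)
      show ?case
      proof
        assume i: "i \<in> {0..1}"
        have "(\<lambda>p :: real \<times> real. (snd p, i, fst p)) \<in> borel_measurable borel"
          by (intro borel_measurable_continuous_onI continuous_intros)
        from measurable_sets[OF this Nb] have "{p. (snd p, i, fst p) \<in> N} \<in> sets borel"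
          by (simp add: vimage_def)
        then have "{p. (snd p, i, fst p) \<notin> N} \<in> sets borel"
          using borel_comp[of "{p. (snd p, i, fst p) \<in> N}"] by (simp add: Collect_neg_eq)
        then have "AE p in (lborel \<Otimes>\<^sub>M lborel :: (real \<times> real) measure). (snd p, i, fst p) \<notin> N"
          using elim by (intro lborel_pair.AE_pair_measure)
            (simp_all only: lborel_prod sets_lborel space_lborel space_borel UNIV_I simp_thms fst_conv snd_conv)
        then have "AE p in (lborel :: (real \<times> real) measure). (snd p, i, fst p) \<notin> N"
          unfolding lborel_prod .
        from AE_lborel_pair[OF AE_lborel_swap[OF this]]
        have *: "AE t in lborel. AE j in lborel. (t, i, j) \<notin> N" by simp
        show "AE t in lebesgue_on {0..}. AE j in unit_leb. a t i j = b t i j"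
        proof (rule AE_lebesgue_onI)
          show "AE t in lborel. t \<in> {0..} \<longrightarrow> (AE j in unit_leb. a t i j = b t i j)"
            using *
            by eventually_elim (use i eq in \<open>auto intro!: AE_lebesgue_onI elim!: eventually_mono\<close>)
        qed simp
      qed
    qed
  qed simp
  show ?thesis
  proof (intro exI[of _ b] kernel_version.intro)
    show "(\<lambda>p. b (fst p) (fst (snd p)) (snd (snd p))) \<in> borel_measurable borel"
    proof -
      have "(\<lambda>p. max 0 (min 1 ((b0 p + b0 (\<sigma> p)) / 2))) \<in> borel_measurable borel"
        by measurable
      then show ?thesis by (simp add: b_def \<sigma>_def)
    qed
    show "b t i j = b t j i" "0 \<le> b t i j" "b t i j \<le> 1" for t i j
      by (simp_all add: b_def add.commute)
  qed (fact 1 2)+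
qed

section \<open>The truncation functional and the spectral gap\<close>

text \<open>For \<open>0 \<le> R\<close> this is \<open>v\<close> minus its nearest point in the
  ball of radius \<open>R\<close>; the case distinction also keeps the divisor positive.\<close>

definition trunc :: "nat \<Rightarrow> real \<Rightarrow> (nat \<Rightarrow> real) \<Rightarrow> nat \<Rightarrow> real" where
  "trunc d R v = (\<lambda>k. (if vnorm d v \<le> R then 0 else 1 - R / vnorm d v) * v k)"

definition excess :: "nat \<Rightarrow> real \<Rightarrow> (nat \<Rightarrow> real) \<Rightarrow> real" where
  "excess d R v = (max 0 (vnorm d v - R))\<^sup>2"

lemma vnorm_triangle: "vnorm d v \<le> vnorm d w + vnorm d (v - w)"
  using vnorm_diff_le[of d w "w - v"] vnorm_diff_commute[of d v w] by simp

text \<open>By Cauchy-Schwarz only the lengths \<open>r\<close> and \<open>r'\<close> matter. What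
  remains is the tangent inequality for the convex scalar function
  \<open>(max 0 (r - R))\<^sup>2\<close>.\<close>

lemma excess_ge:
  assumes R: "0 \<le> R"
  shows "excess d R v + 2 * vdot d (trunc d R v) (v' - v) \<le> excess d R v'"
proof (cases "vnorm d v \<le> R")
  case True
  then show ?thesis by (simp add: excess_def trunc_def vdot_def)
next
  case False
  define r r' where "r = vnorm d v" and "r' = vnorm d v'"
  have r: "R < r" using False by (simp add: r_def)
  have tr: "trunc d R v = (\<lambda>k. (1 - R / r) * v k)" using False by (simp add: trunc_def r_def)
  have "vdot d (trunc d R v) (v' - v) = (1 - R / r) * (vdot d v v' - r\<^sup>2)"
    unfolding tr vdot_scale_left vdot_diff_right r_def vnorm_sq by simp
  also have "\<dots> \<le> (1 - R / r) * (r * r' - r\<^sup>2)"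
    using abs_vdot_le[of d v v'] r R by (intro mult_left_mono) (auto simp: r_def r'_def)
  also have "\<dots> = (r - R) * (r' - r)"
    using r R by (simp add: field_simps power2_eq_square)
  finally have *: "vdot d (trunc d R v) (v' - v) \<le> (r - R) * (r' - r)" .
  have "(r - R)\<^sup>2 + 2 * ((r - R) * (r' - r)) \<le> (max 0 (r' - R))\<^sup>2"
  proof (cases "R \<le> r'")
    case True
    then have "(max 0 (r' - R))\<^sup>2 - ((r - R)\<^sup>2 + 2 * ((r - R) * (r' - r))) = (r' - r)\<^sup>2"
      by (simp add: max_def power2_eq_square algebra_simps)
    then show ?thesis using zero_le_power2[of "r' - r"] by linarith
  next
    case False
    have "(r - R)\<^sup>2 + 2 * ((r - R) * (r' - r)) = (r - R) * (2 * r' - R - r)"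
      by (simp add: power2_eq_square algebra_simps)
    also have "\<dots> \<le> 0" using r False by (intro mult_nonneg_nonpos) auto
    finally show ?thesis by (smt (verit) zero_le_power2)
  qed
  then show ?thesis using * r unfolding excess_def r_def[symmetric] r'_def[symmetric] by (simp add: max_def)
qed

text \<open>\<open>excess\<close> is the squared distance to the ball, and \<open>p\<close> is the
  point of the ball nearest to \<open>v\<close>. The distance from \<open>v'\<close> to the ball is
  at most that from \<open>v'\<close> to \<open>p\<close>; expanding the latter square around
  \<open>v\<close> gives the right side.\<close>

lemma excess_le:
  assumes R: "0 \<le> R"
  shows "excess d R v' \<le> excess d R v + 2 * vdot d (trunc d R v) (v' - v) + (vnorm d (v' - v))\<^sup>2"
proof -
  define p where "p = v - trunc d R v"
  have p: "vnorm d p \<le> R" and tr: "(vnorm d (trunc d R v))\<^sup>2 = excess d R v"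
  proof -
    have "vnorm d p \<le> R \<and> (vnorm d (trunc d R v))\<^sup>2 = excess d R v"
    proof (cases "vnorm d v \<le> R")
      case True
      then have "trunc d R v = (\<lambda>k. 0 * v k)" "p = v"
        by (auto simp: trunc_def p_def fun_eq_iff)
      then show ?thesis using True by (simp only: vnorm_scale) (simp add: excess_def)
    next
      case False
      define r where "r = vnorm d v"
      have r: "R < r" "0 < r" using False R by (auto simp: r_def)
      have tr: "trunc d R v = (\<lambda>k. (1 - R / r) * v k)" using False by (simp add: trunc_def r_def)
      have pe: "p = (\<lambda>k. (R / r) * v k)" unfolding p_def tr by (auto simp: fun_eq_iff algebra_simps)
      have "vnorm d p = R" unfolding pe vnorm_scale r_def[symmetric] using r R by simp
      moreover have "vnorm d (trunc d R v) = r - R"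
        unfolding tr vnorm_scale r_def[symmetric] using r R by (simp add: field_simps)
      ultimately show ?thesis using r by (simp add: excess_def r_def)
    qed
    then show "vnorm d p \<le> R" "(vnorm d (trunc d R v))\<^sup>2 = excess d R v" by auto
  qed
  have "vnorm d v' - R \<le> vnorm d (v' - p)" using vnorm_triangle[of d v' p] p by linarith
  then have "excess d R v' \<le> (vnorm d (v' - p))\<^sup>2"
    unfolding excess_def by (intro power_mono) auto
  also have "v' - p = (v' - v) - (\<lambda>k. (-1) * trunc d R v k)" by (auto simp: p_def fun_eq_iff)
  also have "(vnorm d \<dots>)\<^sup>2 = excess d R v + 2 * vdot d (trunc d R v) (v' - v) + (vnorm d (v' - v))\<^sup>2"
    unfolding vnorm_diff_sq[of d "v' - v"] vnorm_scale vdot_scale_right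
    using tr by (simp add: vdot_commute)
  finally show ?thesis .
qed

text \<open>\<open>trunc d R\<close> is half the gradient of the convex function \<open>excess d R\<close>.\<close>

lemma trunc_monotone:
  assumes "0 \<le> R" shows "0 \<le> vdot d (trunc d R v - trunc d R w) (v - w)"
proof -
  have "vdot d (trunc d R v) (w - v) = - vdot d (trunc d R v) (v - w)"
    by (simp add: vdot_diff_right)
  then show ?thesis
    using excess_ge[OF assms, of d v w] excess_ge[OF assms, of d w v] unfolding vdot_diff_left by linarith
qed

lemma vnorm_trunc_le:
  assumes "0 \<le> R" shows "vnorm d (trunc d R v) \<le> vnorm d v"
proof -
  have "\<bar>if vnorm d v \<le> R then 0 else 1 - R / vnorm d v\<bar> \<le> 1"
    using assms by auto
  then show ?thesis unfolding trunc_def vnorm_scale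
    using mult_right_mono[OF _ vnorm_nonneg] by fastforce
qed

lemma trunc_measurable:
  assumes "f \<in> L2_space d" "k < d"
  shows "(\<lambda>i. trunc d R (f i) k) \<in> borel_measurable unit_leb"
proof -
  have [measurable]: "(\<lambda>i. vnorm d (f i)) \<in> borel_measurable unit_leb"
    using assms by (intro vnorm_measurable L2_space_measurable)
  have [measurable]: "(\<lambda>i. f i k) \<in> borel_measurable unit_leb"
    using assms by (rule L2_space_measurable)
  show ?thesis unfolding trunc_def by measurable
qed

lemma trunc_L2_space:
  assumes R: "0 \<le> R" and f: "f \<in> L2_space d"
  shows "(\<lambda>i. trunc d R (f i)) \<in> L2_space d"
proof (rule L2_spaceI[OF _ L2_space_integrable_sq[OF f]])
  show "(vnorm d (trunc d R (f i)))\<^sup>2 \<le> (vnorm d (f i))\<^sup>2" for i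
    by (intro power_mono vnorm_trunc_le[OF R] vnorm_nonneg)
qed (rule trunc_measurable[OF f])

lemma excess_integrable:
  assumes R: "0 \<le> R" and f: "f \<in> L2_space d"
  shows "integrable unit_leb (\<lambda>i. excess d R (f i))"
proof (rule Bochner_Integration.integrable_bound[OF L2_space_integrable_sq[OF f]])
  have [measurable]: "(\<lambda>i. vnorm d (f i)) \<in> borel_measurable unit_leb"
    using f by (intro vnorm_measurable L2_space_measurable)
  show "(\<lambda>i. excess d R (f i)) \<in> borel_measurable unit_leb"
    unfolding excess_def by measurable
  show "AE i in unit_leb. norm (excess d R (f i)) \<le> norm ((vnorm d (f i))\<^sup>2)"
    using R by (intro AE_I2) (auto simp: excess_def intro!: power_mono)
qed

text \<open>Integrating \<open>excess_ge\<close> and \<open>excess_le\<close> places the first-order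
  remainder between 0 and the squared distance of \<open>f\<close> and \<open>g\<close>, so the
  constant is 1.\<close>

lemma smooth_functional_excess:
  assumes R: "0 \<le> R"
  shows "smooth_functional d (\<lambda>f. LINT i|unit_leb. excess d R (f i)) (\<lambda>g i. trunc d R (g i))"
  unfolding smooth_functional_def
proof (intro conjI exI[of _ 1] ballI)
  fix f g assume f: "f \<in> L2_space d" and g: "g \<in> L2_space d"
  have fg: "f - g \<in> L2_space d" by (rule L2_space_diff[OF f g])
  note ints = excess_integrable[OF R f] excess_integrable[OF R g]
    L2_inner_integrable[OF trunc_L2_space[OF R g] fg] L2_space_integrable_sq[OF fg]
  define D where "D i = excess d R (f i) - excess d R (g i) - 2 * vdot d (trunc d R (g i)) ((f - g) i)" for i
  have D: "integrable unit_leb D" unfolding D_def using ints by auto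
  have eq: "(LINT i|unit_leb. excess d R (f i)) - (LINT i|unit_leb. excess d R (g i))
      - 2 * L2_inner d (\<lambda>i. trunc d R (g i)) (f - g) = (LINT i|unit_leb. D i)"
    unfolding D_def L2_inner_vdot using ints by simp
  have "0 \<le> D i" "D i \<le> (vnorm d ((f - g) i))\<^sup>2" for i
    using excess_ge[OF R, of d "g i" "f i"] excess_le[OF R, of d "f i" "g i"] by (auto simp: D_def)
  then have "0 \<le> (LINT i|unit_leb. D i)"
    and le: "(LINT i|unit_leb. D i) \<le> (LINT i|unit_leb. (vnorm d ((f - g) i))\<^sup>2)"
    using D ints by (auto intro!: integral_nonneg_AE integral_mono)
  moreover have "(LINT i|unit_leb. (vnorm d ((f - g) i))\<^sup>2) = (L2_norm d (f - g))\<^sup>2"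
    unfolding L2_norm_sq L2_inner_vdot vnorm_sq ..
  ultimately show "\<bar>(LINT i|unit_leb. excess d R (f i)) - (LINT i|unit_leb. excess d R (g i))
      - 2 * L2_inner d (\<lambda>i. trunc d R (g i)) (f - g)\<bar> \<le> 1 * (L2_norm d (f - g))\<^sup>2"
    unfolding eq by simp
next
  fix g assume g: "g \<in> L2_space d"
  have "(L2_norm d (\<lambda>i. trunc d R (g i)))\<^sup>2 \<le> (L2_norm d g)\<^sup>2"
    unfolding L2_norm_sq L2_inner_vdot vnorm_sq[symmetric]
    using L2_space_integrable_sq[OF trunc_L2_space[OF R g]] L2_space_integrable_sq[OF g]
    by (intro integral_mono power_mono vnorm_trunc_le[OF R] vnorm_nonneg)
  then show "L2_norm d (\<lambda>i. trunc d R (g i)) \<le> 1 * (1 + L2_norm d g)"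
    using power2_le_imp_le[OF _ L2_norm_nonneg] by fastforce
qed (auto intro: trunc_L2_space[OF R])

section \<open>The averaged Laplacian as a Dirichlet form, and its spectral gap\<close>

lemma L2_inner_cong_AE:
  assumes z: "z \<in> L2_space d" and G: "\<And>k. k < d \<Longrightarrow> (\<lambda>i. G i k) \<in> borel_measurable unit_leb"
    and eq: "AE i in unit_leb. \<forall>k<d. F i k = G i k"
  shows "L2_inner d z F = L2_inner d z G"
  unfolding L2_inner_vdot
proof (rule lebesgue_on_integral_cong_AE)
  show "(\<lambda>i. vdot d (z i) (G i)) \<in> borel_measurable unit_leb"
    by (intro vdot_measurable L2_space_measurable[OF z] G)
  show "AE i in unit_leb. vdot d (z i) (F i) = vdot d (z i) (G i)"
    using eq by eventually_elim (simp add: vdot_def)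
qed simp

lemma integrable_pair_snd:
  fixes g :: "'b \<Rightarrow> real"
  assumes "finite_measure T" "sigma_finite_measure N" "integrable N g"
  shows "integrable (T \<Otimes>\<^sub>M N) (\<lambda>p. g (snd p))"
proof -
  interpret T: finite_measure T by fact
  interpret N: sigma_finite_measure N by fact
  interpret TN: pair_sigma_finite T N ..
  show ?thesis
  proof (rule TN.Fubini_integrable)
    show "(\<lambda>p. g (snd p)) \<in> borel_measurable (T \<Otimes>\<^sub>M N)"
      using measurable_compose[OF measurable_snd borel_measurable_integrable[OF assms(3)]] .
  qed (use assms(3) in simp_all)
qed

lemma integrable_pair_weighted:
  fixes w g :: "_ \<Rightarrow> real"
  assumes T: "finite_measure T" and N: "sigma_finite_measure N" and g: "integrable N g"
    and w: "w \<in> borel_measurable (T \<Otimes>\<^sub>M N)" and b: "\<And>p. \<bar>w p\<bar> \<le> 1"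
  shows "integrable (T \<Otimes>\<^sub>M N) (\<lambda>p. w p * g (snd p))"
proof (rule Bochner_Integration.integrable_bound[OF integrable_pair_snd[OF T N g]])
  show "(\<lambda>p. w p * g (snd p)) \<in> borel_measurable (T \<Otimes>\<^sub>M N)"
    using w borel_measurable_integrable[OF integrable_pair_snd[OF T N g]] by (rule borel_measurable_times)
  show "AE p in T \<Otimes>\<^sub>M N. norm (w p * g (snd p)) \<le> norm (g (snd p))"
    using mult_right_mono[OF b abs_ge_zero] by (intro AE_I2) (simp add: abs_mult)
qed

lemma ident_measurable_lebesgue_on [measurable]: "(\<lambda>t :: real. t) \<in> borel_measurable (lebesgue_on S)"
  by (intro measurable_restrict_space1 measurable_completion) simp

lemma fst_measurable_lebesgue_on [measurable]: "fst \<in> borel_measurable (lebesgue_on (S :: real set) \<Otimes>\<^sub>M N)"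
  by (rule measurable_compose[OF measurable_fst ident_measurable_lebesgue_on])

context kernel_version
begin

lemma abs_b_le: "\<bar>b t i j\<bar> \<le> 1"
  using b_nonneg[of t i j] b_le_1[of t i j] by simp

lemma b_measurable [measurable (raw)]:
  assumes [measurable]: "f \<in> borel_measurable N" "g \<in> borel_measurable N" "h \<in> borel_measurable N"
  shows "(\<lambda>p. b (f p) (g p) (h p)) \<in> borel_measurable N"
proof -
  have "(\<lambda>p. (f p, g p, h p)) \<in> N \<rightarrow>\<^sub>M borel"
    unfolding borel_prod[symmetric] by measurable
  from measurable_compose[OF this b_borel] show ?thesis by simp
qed

text \<open>Averaging in time commutes with the Laplacian: the averaged operator has the kernel
  \<open>w\<close>, the time average of \<open>b\<close>, which is again symmetric and bounded. The
  symmetrised pairing and Fubini between time and the square then give the formula.\<close>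

lemma averaged_laplacian_inner:
  assumes y: "y \<in> L2_space d" and t: "0 \<le> t" and \<tau>: "0 < \<tau>"
  defines "q \<equiv> \<lambda>s. LINT p|unit_sq. b s (fst p) (snd p) * (vnorm d (y (fst p) - y (snd p)))\<^sup>2"
  shows "integrable (lebesgue_on {t..t+\<tau>}) q"
    and "L2_inner d (averaged_operator (graph_laplacian a) \<tau> t y) y
      = 1 / (2 * \<tau>) * (LINT s|lebesgue_on {t..t+\<tau>}. q s)"
proof -
  let ?T = "lebesgue_on {t..t+\<tau>}"
  interpret T: finite_measure ?T by (auto intro: finite_measure_lebesgue_on)
  interpret TJ: pair_sigma_finite ?T unit_leb ..
  interpret TP: pair_sigma_finite ?T unit_sq ..
  have Tm: "measure ?T (space ?T) = \<tau>" using \<tau> by (simp add: measure_restrict_space)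
  have qi: "integrable (?T \<Otimes>\<^sub>M unit_sq)
      (\<lambda>(s, p). b s (fst p) (snd p) * (vnorm d (y (fst p) - y (snd p)))\<^sup>2)"
    unfolding case_prod_unfold
    by (rule integrable_pair_weighted[OF T.finite_measure_axioms _ integrable_vnorm_diff_sq[OF y]])
      (auto intro!: abs_b_le unit_sq.P.sigma_finite_measure_axioms)
  show "integrable ?T q" unfolding q_def by (rule TP.integrable_fst[OF qi])
  define w where "w i j = 1 / \<tau> * (LINT s|?T. b s i j)" for i j
  have wm: "(\<lambda>p. w (fst p) (snd p)) \<in> borel_measurable unit_sq"
    unfolding w_def by measurable
  have bi: "integrable ?T (\<lambda>s. b s i j)" for i j
    by (rule T.integrable_const_bound[of _ 1]) (auto simp: abs_b_le)
  have wb: "\<bar>w i j\<bar> \<le> 1" for i j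
  proof -
    have "\<bar>LINT s|?T. b s i j\<bar> \<le> (LINT s|?T. \<bar>b s i j\<bar>)" by (rule integral_abs_bound)
    also have "\<dots> \<le> (LINT s|?T. 1)" by (rule integral_mono) (use bi abs_b_le in auto)
    finally show ?thesis using \<tau> Tm by (simp add: w_def abs_mult field_simps)
  qed
  have ws: "w i j = w j i" for i j unfolding w_def by (subst b_sym) simp
  have T_eq: "AE i in unit_leb. \<forall>k<d. averaged_operator (graph_laplacian a) \<tau> t y i k
      = - (LINT j|unit_leb. w i j * (y j k - y i k))"
    \<comment> \<open>The averaged operator integrates over time at a fixed \<open>i\<close>, so the
      order with \<open>i\<close> outermost is the one required.\<close>
    using a_eq_b'
  proof eventually_elim
    case (elim i)
    have ae: "AE s in ?T. AE j in unit_leb. a s i j = b s i j"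
      using AE_lebesgue_on_Icc[OF elim t] by eventually_elim simp
    show ?case
    proof (intro allI impI)
      fix k assume k: "k < d"
      have yk: "integrable unit_leb (\<lambda>j. y i k - y j k)"
        using L2_space_component_integrable[OF y k] by simp
      have pi: "integrable (?T \<Otimes>\<^sub>M unit_leb) (\<lambda>(s, j). b s i j * (y i k - y j k))"
        unfolding case_prod_unfold
        by (rule integrable_pair_weighted[OF T.finite_measure_axioms _ yk])
          (auto intro!: abs_b_le unit_leb.sigma_finite_measure_axioms)
      have "(LINT s|?T. graph_laplacian a s y i k) = (LINT s|?T. LINT j|unit_leb. b s i j * (y i k - y j k))"
      proof (rule lebesgue_on_integral_cong_AE)
        show "(\<lambda>s. LINT j|unit_leb. b s i j * (y i k - y j k)) \<in> borel_measurable ?T"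
          using TJ.integrable_fst[OF pi] by simp
        show "AE s in ?T. graph_laplacian a s y i k = (LINT j|unit_leb. b s i j * (y i k - y j k))"
          using ae
        proof eventually_elim
          case (elim s)
          show ?case unfolding graph_laplacian_def
          proof (rule lebesgue_on_integral_cong_AE)
            show "(\<lambda>j. b s i j * (y i k - y j k)) \<in> borel_measurable unit_leb"
              by (intro borel_measurable_times borel_measurable_integrable[OF yk]) measurable
            show "AE j in unit_leb. a s i j * (y i k - y j k) = b s i j * (y i k - y j k)"
              using elim by eventually_elim simp
          qed simp
        qed
      qed simp
      also have "\<dots> = (LINT j|unit_leb. LINT s|?T. b s i j * (y i k - y j k))"
        by (rule TJ.Fubini_integral[OF pi, symmetric])
      also have "\<dots> = (LINT j|unit_leb. - \<tau> * (w i j * (y j k - y i k)))"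
      proof (intro Bochner_Integration.integral_cong refl)
        fix j
        have eq: "(LINT s|?T. b s i j * (y i k - y j k)) = (LINT s|?T. b s i j) * (y i k - y j k)" by simp
        show "(LINT s|?T. b s i j * (y i k - y j k)) = - \<tau> * (w i j * (y j k - y i k))"
          unfolding eq using \<tau> by (simp add: w_def field_simps)
      qed
      finally show "averaged_operator (graph_laplacian a) \<tau> t y i k
          = - (LINT j|unit_leb. w i j * (y j k - y i k))"
        using \<tau> by (simp add: averaged_operator_def)
    qed
  qed
  have "L2_inner d (averaged_operator (graph_laplacian a) \<tau> t y) y
      = L2_inner d y (\<lambda>i k. (-1) * (LINT j|unit_leb. w i j * (y j k - y i k)))"
    unfolding L2_inner_commute[of d _ y]
  proof (rule L2_inner_cong_AE[OF y])
    show "(\<lambda>i. (-1) * (LINT j|unit_leb. w i j * (y j k - y i k))) \<in> borel_measurable unit_leb" if "k < d" for k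
      by (rule borel_measurable_times[OF borel_measurable_const weighted_field_measurable[OF wm y that]])
  qed (use T_eq in simp)
  also have "\<dots> = 1 / 2 * (LINT p|unit_sq. w (fst p) (snd p) * (vnorm d (y (fst p) - y (snd p)))\<^sup>2)"
    unfolding L2_inner_scale_right L2_inner_weighted_field[OF wm wb ws y y] vnorm_sq by simp
  also have "(LINT p|unit_sq. w (fst p) (snd p) * (vnorm d (y (fst p) - y (snd p)))\<^sup>2)
      = 1 / \<tau> * (LINT p|unit_sq. LINT s|?T. b s (fst p) (snd p) * (vnorm d (y (fst p) - y (snd p)))\<^sup>2)"
    unfolding w_def by (simp add: mult.assoc)
  also have "(LINT p|unit_sq. LINT s|?T. b s (fst p) (snd p) * (vnorm d (y (fst p) - y (snd p)))\<^sup>2)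
      = (LINT s|?T. q s)"
    unfolding q_def by (rule TP.Fubini_integral[OF qi])
  finally show "L2_inner d (averaged_operator (graph_laplacian a) \<tau> t y) y
      = 1 / (2 * \<tau>) * (LINT s|?T. q s)" by simp
qed

text \<open>The averaged Laplacian is compared with its smallest Rayleigh quotient. The case
  \<open>L2_norm d y = 0\<close> is separate, since \<open>lambda2\<close> says nothing about it;
  there the energy is nonnegative.\<close>

lemma lambda2_spectral_gap:
  assumes y: "y \<in> consensus_perp d" and t: "0 \<le> t" and \<tau>: "0 < \<tau>"
    and gap: "\<mu> \<le> lambda2 d (averaged_operator (graph_laplacian a) \<tau> t)"
  shows "2 * \<tau> * \<mu> * (L2_norm d y)\<^sup>2 \<le> (LINT s|lebesgue_on {t..t+\<tau>}.
    LINT p|unit_sq. b s (fst p) (snd p) * (vnorm d (y (fst p) - y (snd p)))\<^sup>2)"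
proof -
  define Q where "Q z = (LINT s|lebesgue_on {t..t+\<tau>}.
    LINT p|unit_sq. b s (fst p) (snd p) * (vnorm d (z (fst p) - z (snd p)))\<^sup>2)" for z
  let ?L = "averaged_operator (graph_laplacian a) \<tau> t"
  have L2: "z \<in> L2_space d" if "z \<in> consensus_perp d" for z
    using that by (simp add: consensus_perp_def)
  have Q0: "0 \<le> Q z" for z
    unfolding Q_def by (intro Bochner_Integration.integral_nonneg mult_nonneg_nonneg b_nonneg zero_le_power2)
  have eq: "L2_inner d (?L z) z = 1 / (2 * \<tau>) * Q z" if "z \<in> consensus_perp d" for z
    unfolding Q_def by (rule averaged_laplacian_inner[OF L2[OF that] t \<tau>])
  have "2 * \<tau> * \<mu> * (L2_norm d y)\<^sup>2 \<le> Q y"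
  proof (cases "L2_norm d y = 0")
    case True
    then show ?thesis using Q0[of y] by simp
  next
    case False
    have ne: "\<not> L2_eq d y (\<lambda>_ _. 0)"
    proof
      assume "L2_eq d y (\<lambda>_ _. 0)"
      then have "AE i in unit_leb. \<forall>k<d. y i k = 0" by (simp add: L2_eq_def)
      from L2_inner_cong_AE[OF L2[OF y] _ this] have "L2_inner d y y = L2_inner d y (\<lambda>_ _. 0)" by simp
      also have "\<dots> = 0" by (simp add: L2_inner_def)
      finally show False using False by (simp add: L2_norm_sq[symmetric])
    qed
    have "lambda2 d ?L \<le> L2_inner d (?L y) y / (L2_norm d y)\<^sup>2"
      unfolding lambda2_def
    proof (rule cINF_lower)
      \<comment> \<open>A real infimum lies below its members only for a set bounded below;
        nonnegativity of \<open>b\<close> supplies the bound 0.\<close>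
      show "bdd_below ((\<lambda>y. L2_inner d (?L y) y / (L2_norm d y)\<^sup>2) ` {y \<in> consensus_perp d. \<not> L2_eq d y (\<lambda>_ _. 0)})"
        using Q0 \<tau> by (intro bdd_belowI2[of _ 0]) (auto simp: eq)
    qed (use y ne in simp)
    with gap have "\<mu> \<le> (1 / (2 * \<tau>) * Q y) / (L2_norm d y)\<^sup>2" unfolding eq[OF y] by simp
    moreover have "0 < (L2_norm d y)\<^sup>2" using False by simp
    ultimately show ?thesis using \<tau> by (simp add: field_simps)
  qed
  then show ?thesis unfolding Q_def .
qed

end

section \<open>Decay of the variance along the flow\<close>

lemma L2_inner_const_left:
  assumes "k < d"
  shows "L2_inner d (\<lambda>_ l. if l = k then 1 else 0) f = barycenter f k"
  unfolding L2_inner_commute[of d _ f]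
  using assms by (simp add: L2_inner_def barycenter_def if_distrib cong: if_cong)

text \<open>The upper bound \<open>M\<close> holds for all arguments of \<open>\<phi>\<close>, the
  lower bound \<open>m\<close> only up to \<open>2 * R\<close>: a positive \<open>\<phi>\<close> may
  tend to 0 at infinity.\<close>

locale graphon_flow = kernel_version a b
  for a b :: "real \<Rightarrow> real \<Rightarrow> real \<Rightarrow> real" +
  fixes d :: nat and \<phi> :: "real \<Rightarrow> real" and x0 :: "real \<Rightarrow> nat \<Rightarrow> real"
    and x :: "real \<Rightarrow> real \<Rightarrow> nat \<Rightarrow> real" and R M m \<mu> \<tau> :: real
  assumes \<phi>_cont: "continuous_on {0..} \<phi>"
    and \<phi>_nonneg: "\<And>r. 0 \<le> r \<Longrightarrow> 0 \<le> \<phi> r" and \<phi>_le: "\<And>r. 0 \<le> r \<Longrightarrow> \<phi> r \<le> M"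
    and \<phi>_ge: "\<And>r. 0 \<le> r \<Longrightarrow> r \<le> 2 * R \<Longrightarrow> m \<le> \<phi> r"
    and M: "0 < M" and m: "0 < m" and R: "0 \<le> R" and \<tau>: "0 < \<tau>"
    and sol: "graphon_solution d a \<phi> x0 x"
    and x0_bound: "AE i in unit_leb. vnorm d (x0 i) \<le> R"
    and x0_meas: "\<And>k. k < d \<Longrightarrow> (\<lambda>i. x0 i k) \<in> borel_measurable unit_leb"
    and gap: "\<And>t. 0 \<le> t \<Longrightarrow> \<mu> \<le> lambda2 d (averaged_operator (graph_laplacian a) \<tau> t)"
begin

definition weight :: "real \<Rightarrow> (real \<Rightarrow> nat \<Rightarrow> real) \<Rightarrow> real \<times> real \<Rightarrow> real" where
  "weight t y p = b t (fst p) (snd p) * \<phi> (vnorm d (y (fst p) - y (snd p)))"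

definition diss :: "real \<Rightarrow> (real \<Rightarrow> nat \<Rightarrow> real) \<Rightarrow> real" where
  "diss t y = (LINT p|unit_sq. weight t y p * (vnorm d (y (fst p) - y (snd p)))\<^sup>2)"

abbreviation c :: "real \<Rightarrow> nat \<Rightarrow> real" where "c \<equiv> \<lambda>_. barycenter x0"

definition V :: "real \<Rightarrow> real" where "V t = (L2_norm d (x t - c))\<^sup>2"

lemma x_L2: "0 \<le> t \<Longrightarrow> x t \<in> L2_space d"
  using sol by (simp add: graphon_solution_def Lip_loc_L2_def)

lemma weight_nonneg: "0 \<le> weight t y p"
  by (simp add: weight_def b_nonneg \<phi>_nonneg)

lemma weight_le: "weight t y p \<le> M"
  using mult_mono[OF b_le_1 \<phi>_le[OF vnorm_nonneg]] \<phi>_nonneg[OF vnorm_nonneg]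
  by (fastforce simp: weight_def)

lemma abs_weight_le: "\<bar>weight t y p\<bar> \<le> M"
  using weight_nonneg[of t y p] weight_le[of t y p] by simp

lemma weight_measurable:
  assumes y: "y \<in> L2_space d"
  shows "weight t y \<in> borel_measurable unit_sq"
proof -
  \<comment> \<open>Composition with \<open>max 0\<close> turns continuity on the half line into
    Borel measurability on the line, and changes nothing at a norm.\<close>
  have "continuous_on UNIV (\<lambda>r. \<phi> (max 0 r))"
    by (intro continuous_on_compose2[OF \<phi>_cont] continuous_intros) auto
  then have "(\<lambda>r. \<phi> (max 0 r)) \<in> borel_measurable borel"
    by (rule borel_measurable_continuous_onI)
  moreover have "(\<lambda>p. vnorm d (y (fst p) - y (snd p))) \<in> borel_measurable unit_sq"
    by (intro vnorm_measurable) (rule L2_space_measurable_diff[OF y])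
  ultimately have "(\<lambda>p. \<phi> (max 0 (vnorm d (y (fst p) - y (snd p))))) \<in> borel_measurable unit_sq"
    by (rule measurable_compose[rotated])
  then have [measurable]: "(\<lambda>p. \<phi> (vnorm d (y (fst p) - y (snd p)))) \<in> borel_measurable unit_sq"
    by simp
  have [measurable]: "fst \<in> borel_measurable unit_sq" "snd \<in> borel_measurable unit_sq"
    by (rule measurable_compose[OF measurable_fst ident_measurable_lebesgue_on]
        measurable_compose[OF measurable_snd ident_measurable_lebesgue_on])+
  show ?thesis unfolding weight_def by measurable
qed

lemma diss_nonneg: "0 \<le> diss t y"
  unfolding diss_def by (intro Bochner_Integration.integral_nonneg mult_nonneg_nonneg weight_nonneg zero_le_power2)

lemma diss_integrable:
  "y \<in> L2_space d \<Longrightarrow> integrable unit_sq (\<lambda>p. weight t y p * (vnorm d (y (fst p) - y (snd p)))\<^sup>2)"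
  unfolding vnorm_sq by (rule integrable_weighted_vdot[OF weight_measurable abs_weight_le])

text \<open>For a fixed state \<open>y\<close> the factor \<open>\<phi>\<close> belongs to a
  symmetric kernel, and the weighted field identity applies. The quantifiers over \<open>z\<close>
  and \<open>y\<close> stand inside the AE, so one null set of times serves every test function,
  also one that varies with time.\<close>

lemma field_inner:
  "AE t in lebesgue_on {0..}. \<forall>z\<in>L2_space d. \<forall>y\<in>L2_space d. L2_inner d z (graphon_field d a \<phi> t y)
    = - (1 / 2) * (LINT p|unit_sq. weight t y p * vdot d (z (fst p) - z (snd p)) (y (fst p) - y (snd p)))"
  using a_eq_b
proof eventually_elim
  case (elim t)
  show ?case
  proof (intro ballI)
    fix z y assume z: "z \<in> L2_space d" and y: "y \<in> L2_space d"
    define w where "w i j = weight t y (i, j)" for i j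
    have wm: "(\<lambda>p. w (fst p) (snd p)) \<in> borel_measurable unit_sq"
      using weight_measurable[OF y] by (simp add: w_def)
    have ws: "w i j = w j i" for i j
      unfolding w_def weight_def fst_conv snd_conv using b_sym[of t i j] vnorm_diff_commute[of d "y i" "y j"] by simp
    have "L2_inner d z (graphon_field d a \<phi> t y) = L2_inner d z (\<lambda>i k. LINT j|unit_leb. w i j * (y j k - y i k))"
    proof (rule L2_inner_cong_AE[OF z weighted_field_measurable[OF wm y]])
      show "AE i in unit_leb. \<forall>k<d. graphon_field d a \<phi> t y i k = (LINT j|unit_leb. w i j * (y j k - y i k))"
        using elim AE_space
      proof eventually_elim
        case (elim i)
        show ?case
        proof (intro allI impI)
          fix k assume k: "k < d"
          show "graphon_field d a \<phi> t y i k = (LINT j|unit_leb. w i j * (y j k - y i k))"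
            unfolding graphon_field_def
          proof (rule lebesgue_on_integral_cong_AE)
            have "(\<lambda>j. w i j) \<in> borel_measurable unit_leb"
              using measurable_compose[OF measurable_Pair1'[OF elim(2)] wm] by simp
            then show "(\<lambda>j. w i j * (y j k - y i k)) \<in> borel_measurable unit_leb"
              by (intro borel_measurable_times borel_measurable_diff L2_space_measurable[OF y k]) auto
            show "AE j in unit_leb. a t i j * \<phi> (vnorm d (y i - y j)) * (y j k - y i k) = w i j * (y j k - y i k)"
              using elim(1) by eventually_elim (simp add: w_def weight_def)
          qed simp
        qed
      qed
    qed
    also have "\<dots> = - (1 / 2) * (LINT p|unit_sq. w (fst p) (snd p) * vdot d (z (fst p) - z (snd p)) (y (fst p) - y (snd p)))"
      by (rule L2_inner_weighted_field[OF wm _ ws z y, of M]) (simp add: w_def abs_weight_le)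
    finally show "L2_inner d z (graphon_field d a \<phi> t y)
        = - (1 / 2) * (LINT p|unit_sq. weight t y p * vdot d (z (fst p) - z (snd p)) (y (fst p) - y (snd p)))"
      by (simp add: w_def)
  qed
qed

text \<open>The factor 2 of the half-gradient convention cancels the factor 1/2 of
  \<open>field_inner\<close>. The null sets of times are dealt with here once, so callers check a
  bound at every \<open>r\<close>.\<close>

lemma functional_integral_le:
  assumes \<Phi>: "smooth_functional d \<Phi> n" and s: "0 \<le> s" "s \<le> t"
    and A: "integrable (lebesgue_on {s..t}) A"
    and le: "\<And>r. s \<le> r \<Longrightarrow> r \<le> t \<Longrightarrow> A r \<le>
      - (LINT p|unit_sq. weight r (x r) p * vdot d (n (x r) (fst p) - n (x r) (snd p)) (x r (fst p) - x r (snd p)))"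
  shows "(LINT r|lebesgue_on {s..t}. A r) \<le> \<Phi> (x t) - \<Phi> (x s)"
proof (rule smooth_functional_integral_le[OF sol \<Phi> s A])
  have n: "n y \<in> L2_space d" if "y \<in> L2_space d" for y
    using \<Phi> that by (auto simp: smooth_functional_def)
  show "AE r in lebesgue_on {s..t}. A r \<le> 2 * L2_inner d (n (x r)) (graphon_field d a \<phi> r (x r))"
    using AE_lebesgue_on_Icc[OF field_inner s(1)] AE_space
  proof eventually_elim
    case (elim r)
    then have r: "s \<le> r" "r \<le> t" by auto
    have xr: "x r \<in> L2_space d" using r s by (intro x_L2) auto
    show ?case using elim(1) le[OF r] n[OF xr] xr by auto
  qed
qed

lemma functional_mono:
  assumes \<Phi>: "smooth_functional d \<Phi> n" and s: "0 \<le> s" "s \<le> t"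
    and le: "\<And>r. s \<le> r \<Longrightarrow> r \<le> t \<Longrightarrow>
      (LINT p|unit_sq. weight r (x r) p * vdot d (n (x r) (fst p) - n (x r) (snd p)) (x r (fst p) - x r (snd p))) \<le> 0"
  shows "\<Phi> (x s) \<le> \<Phi> (x t)"
  using functional_integral_le[OF \<Phi> s, of "\<lambda>_. 0"] le by fastforce

section \<open>Invariants of the flow: barycenter, ball of radius \<open>R\<close>, decreasing
  variance\<close>

lemma x0_AE: "AE i in unit_leb. \<forall>k<d. x 0 i k = x0 i k"
  using sol by (simp add: graphon_solution_def L2_eq_def)

text \<open>A constant test function has zero differences, so the Dirichlet form vanishes.
  Monotonicity of the functional and of its negative gives equality.\<close>

lemma barycenter_conserved:
  assumes t: "0 \<le> t" and k: "k < d"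
  shows "barycenter (x t) k = barycenter x0 k"
proof -
  define e :: "real \<Rightarrow> nat \<Rightarrow> real" where "e = (\<lambda>_ l. if l = k then 1 else 0)"
  have e: "e \<in> L2_space d" unfolding e_def by (rule L2_space_const)
  have B: "L2_inner d e f = barycenter f k" for f unfolding e_def by (rule L2_inner_const_left[OF k])
  have ed: "vdot d (e i - e j) v = 0" for i j v by (simp add: e_def vdot_def)
  have ed': "vdot d ((\<lambda>k. (-1) * e i k) - (\<lambda>k. (-1) * e j k)) v = 0" for i j v by (simp add: e_def vdot_def)
  have "2 * L2_inner d e (x 0) \<le> 2 * L2_inner d e (x t)"
    by (rule functional_mono[OF smooth_functional_inner[OF e] order_refl t]) (simp only: ed mult_zero_right integral_zero)
  moreover have "(-1) * (2 * L2_inner d e (x 0)) \<le> (-1) * (2 * L2_inner d e (x t))"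
    by (rule functional_mono[OF smooth_functional_scale[OF smooth_functional_inner[OF e]] order_refl t])
      (simp only: ed' mult_zero_right integral_zero)
  moreover have "barycenter (x 0) k = barycenter x0 k"
    unfolding barycenter_def
    by (rule lebesgue_on_integral_cong_AE) (use x0_AE k x0_meas in \<open>auto elim: eventually_mono\<close>)
  ultimately show ?thesis by (simp add: B)
qed

lemma vnorm_bound:
  assumes t: "0 \<le> t"
  shows "AE i in unit_leb. vnorm d (x t i) \<le> R"
proof -
  let ?W = "\<lambda>f. LINT i|unit_leb. excess d R (f i)"
  have "(-1) * ?W (x 0) \<le> (-1) * ?W (x t)"
  proof (rule functional_mono[OF smooth_functional_scale[OF smooth_functional_excess[OF R]] order_refl t])
    fix r
    define G where "G p = weight r (x r) p * vdot d ((\<lambda>k. (-1) * trunc d R (x r (fst p)) k)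
        - (\<lambda>k. (-1) * trunc d R (x r (snd p)) k)) (x r (fst p) - x r (snd p))" for p
    have "0 \<le> - G p" for p
    proof -
      have "(\<lambda>k. (-1) * trunc d R (x r (fst p)) k) - (\<lambda>k. (-1) * trunc d R (x r (snd p)) k)
          = (\<lambda>k. (-1) * (trunc d R (x r (fst p)) - trunc d R (x r (snd p))) k)" by (auto simp: fun_eq_iff)
      then have "- G p = weight r (x r) p * vdot d (trunc d R (x r (fst p)) - trunc d R (x r (snd p))) (x r (fst p) - x r (snd p))"
        unfolding G_def by (simp only: vdot_scale_left)
      then show ?thesis
        using mult_nonneg_nonneg[OF weight_nonneg trunc_monotone[OF R]] by (simp only:)
    qed
    \<comment> \<open>The pointwise sign suffices: if \<open>G\<close> failed to be integrable, the
      integral would be 0.\<close>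
    then have "0 \<le> (LINT p|unit_sq. - G p)" by (rule Bochner_Integration.integral_nonneg)
    then have "(LINT p|unit_sq. G p) \<le> 0" by simp
    then show "(LINT p|unit_sq. weight r (x r) p * vdot d ((\<lambda>k. (-1) * trunc d R (x r (fst p)) k) - (\<lambda>k. (-1) * trunc d R (x r (snd p)) k))
        (x r (fst p) - x r (snd p))) \<le> 0"
      unfolding G_def .
  qed
  moreover have "?W (x 0) = (LINT i|unit_leb. 0)"
  proof (rule lebesgue_on_integral_cong_AE)
    show "AE i in unit_leb. excess d R (x 0 i) = 0"
      using x0_AE x0_bound
    proof eventually_elim
      case (elim i)
      have "vnorm d (x 0 i) = vnorm d (x0 i)"
        unfolding vnorm_def by (rule L2_set_cong) (use elim in auto)
      then show ?case using elim by (simp add: excess_def)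
    qed
  qed auto
  moreover have "0 \<le> ?W (x t)"
    by (rule Bochner_Integration.integral_nonneg) (simp add: excess_def)
  ultimately have "?W (x t) = 0" by simp
  then have "AE i in unit_leb. excess d R (x t i) = 0"
    by (subst (asm) integral_nonneg_eq_0_iff_AE[OF excess_integrable[OF R x_L2[OF t]]]) (auto simp: excess_def)
  then show ?thesis by eventually_elim (auto simp: excess_def max_def split: if_splits)
qed

lemma vnorm_diff_bound:
  assumes t: "0 \<le> t"
  shows "AE p in unit_sq. vnorm d (x t (fst p) - x t (snd p)) \<le> 2 * R"
proof -
  have [measurable]: "(\<lambda>p. vnorm d (x t (fst p) - x t (snd p))) \<in> borel_measurable unit_sq"
    by (intro vnorm_measurable) (rule L2_space_measurable_diff[OF x_L2[OF t]])
  have "AE i in unit_leb. AE j in unit_leb. vnorm d (x t i - x t j) \<le> 2 * R"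
    using vnorm_bound[OF t]
  proof eventually_elim
    case (elim i)
    show ?case using vnorm_bound[OF t]
    proof eventually_elim
      case (elim j)
      then show ?case using \<open>vnorm d (x t i) \<le> R\<close> vnorm_diff_le[of d "x t i" "x t j"] by linarith
    qed
  qed
  then show ?thesis by (intro unit_sq.AE_pair_measure) auto
qed

lemma c_L2: "c \<in> L2_space d" by (rule L2_space_const)

text \<open>Conservation of the barycenter makes the spectral gap applicable at the start of every
  window with the same constant \<open>c\<close>.\<close>

lemma shifted_perp:
  assumes t: "0 \<le> t" shows "x t - c \<in> consensus_perp d"
proof -
  have "barycenter (x t - c) k = 0" if k: "k < d" for k
    using L2_space_component_integrable[OF x_L2[OF t] k] barycenter_conserved[OF t k]
      unit_leb.prob_space by (simp add: barycenter_def)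
  then show ?thesis unfolding consensus_perp_eq_zero_mean using L2_space_diff[OF x_L2[OF t] c_L2] by simp
qed

lemma V_antimono:
  assumes s: "0 \<le> s" "s \<le> t" shows "V t \<le> V s"
proof -
  have "(-1) * V s \<le> (-1) * V t"
    unfolding V_def
  proof (rule functional_mono[OF smooth_functional_scale[OF smooth_functional_sqdist[OF c_L2]] s])
    fix r
    have "(\<lambda>k. (-1) * (x r - c) i k) - (\<lambda>k. (-1) * (x r - c) j k) = (\<lambda>k. (-1) * (x r i - x r j) k)" for i j
      by (auto simp: fun_eq_iff)
    then have "(LINT p|unit_sq. weight r (x r) p * vdot d ((\<lambda>k. (-1) * (x r - c) (fst p) k) - (\<lambda>k. (-1) * (x r - c) (snd p) k))
        (x r (fst p) - x r (snd p))) = (-1) * diss r (x r)"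
      by (simp only: vdot_scale_left vnorm_sq diss_def mult.left_commute[of _ "-1"] integral_mult_right_zero)
    then show "(LINT p|unit_sq. weight r (x r) p * vdot d ((\<lambda>k. (-1) * (x r - c) (fst p) k) - (\<lambda>k. (-1) * (x r - c) (snd p) k))
        (x r (fst p) - x r (snd p))) \<le> 0"
      using diss_nonneg[of r "x r"] by (simp only:)
  qed
  then show ?thesis by simp
qed

section \<open>Contraction of the variance on one window\<close>

text \<open>Testing the equation against \<open>z = x t - x s\<close> bounds the displacement by the dissipated energy.\<close>

lemma displacement_le:
  assumes s: "0 \<le> s" "s \<le> t" "t \<le> s + \<tau>"
  shows "(L2_norm d (x t - x s))\<^sup>2 \<le> M * \<tau> * (V s - V t)"
proof -
  define z where "z = x t - x s"
  define Z where "Z = (L2_norm d z)\<^sup>2"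
  have xs: "x s \<in> L2_space d" "x t \<in> L2_space d" using s by (auto intro: x_L2)
  have z: "z \<in> L2_space d" unfolding z_def by (intro L2_space_diff xs)
  \<comment> \<open>With this choice the term \<open>2 * e * M * Z\<close>, accumulated over a time
    of at most \<open>\<tau>\<close>, costs at most \<open>Z\<close>, half of the
    \<open>2 * Z\<close> gained by the displacement.\<close>
  define e where "e = 1 / (2 * M * \<tau>)"
  have e: "0 < e" using M \<tau> by (simp add: e_def)
  define A where "A = - (2 * e * M * Z)"
  \<comment> \<open>The squared distance is added so that its derivative, \<open>1 / (2 * e)\<close>
    times the dissipation, pays for the dissipation produced by Young's inequality. The sum then has
    the constant \<open>A\<close> as a lower bound for its derivative.\<close>
  let ?\<Phi> = "\<lambda>f. (-1) * (2 * L2_inner d z f) + (- (1 / (2 * e))) * (L2_norm d (f - c))\<^sup>2"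
  let ?n = "\<lambda>f. (\<lambda>i k. (-1) * z i k) + (\<lambda>i k. (- (1 / (2 * e))) * (f - c) i k)"
  have "(LINT r|lebesgue_on {s..t}. A) \<le> ?\<Phi> (x t) - ?\<Phi> (x s)"
  proof (rule functional_integral_le[OF smooth_functional_add[OF
        smooth_functional_scale[OF smooth_functional_inner[OF z]]
        smooth_functional_scale[OF smooth_functional_sqdist[OF c_L2]]] s(1,2)])
    show "integrable (lebesgue_on {s..t}) (\<lambda>_. A)"
      by (rule finite_measure.integrable_const) (auto intro: finite_measure_lebesgue_on)
    fix r assume r: "s \<le> r" "r \<le> t"
    define y where "y = x r"
    have y: "y \<in> L2_space d" unfolding y_def using r s by (intro x_L2) auto
    note yi = diss_integrable[OF y, of r]
    have zi: "integrable unit_sq (\<lambda>p. weight r y p * vdot d (z (fst p) - z (snd p)) (y (fst p) - y (snd p)))"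
      by (rule integrable_weighted_vdot[OF weight_measurable[OF y] abs_weight_le z y])
    have n: "?n y i - ?n y j = (\<lambda>k. (-1) * (z i - z j) k) - (\<lambda>k. 1 / (2 * e) * (y i - y j) k)" for i j
      by (rule ext) (simp add: algebra_simps diff_divide_distrib)
    have split: "weight r y p * vdot d (?n y (fst p) - ?n y (snd p)) (y (fst p) - y (snd p))
      = - (weight r y p * vdot d (z (fst p) - z (snd p)) (y (fst p) - y (snd p)))
        - 1 / (2 * e) * (weight r y p * (vnorm d (y (fst p) - y (snd p)))\<^sup>2)" for p
      unfolding n vdot_diff_left[of d "\<lambda>k. (-1) * (z (fst p) - z (snd p)) k"] vdot_scale_left vnorm_sq
      by (simp only: right_diff_distrib mult.left_commute)
    have "- (LINT p|unit_sq. weight r y p * vdot d (z (fst p) - z (snd p)) (y (fst p) - y (snd p)))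
        \<le> (LINT p|unit_sq. M * (e / 2) * (vnorm d (z (fst p) - z (snd p)))\<^sup>2
          + 1 / (2 * e) * (weight r y p * (vnorm d (y (fst p) - y (snd p)))\<^sup>2))"
      unfolding Bochner_Integration.integral_minus[symmetric]
    proof (rule integral_mono)
      show "integrable unit_sq (\<lambda>p. M * (e / 2) * (vnorm d (z (fst p) - z (snd p)))\<^sup>2
          + 1 / (2 * e) * (weight r y p * (vnorm d (y (fst p) - y (snd p)))\<^sup>2))"
        by (intro Bochner_Integration.integrable_add integrable_mult_right integrable_vnorm_diff_sq z yi)
      fix p
      have "- (weight r y p * vdot d (z (fst p) - z (snd p)) (y (fst p) - y (snd p)))
          \<le> weight r y p * \<bar>vdot d (z (fst p) - z (snd p)) (y (fst p) - y (snd p))\<bar>"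
        using weight_nonneg[of r y p] abs_ge_minus_self
        by (metis minus_mult_right mult_left_mono)
      also have "\<dots> \<le> weight r y p * (e / 2 * (vnorm d (z (fst p) - z (snd p)))\<^sup>2 + 1 / (2 * e) * (vnorm d (y (fst p) - y (snd p)))\<^sup>2)"
        by (intro mult_left_mono vdot_young e weight_nonneg)
      also have "\<dots> = weight r y p * (e / 2 * (vnorm d (z (fst p) - z (snd p)))\<^sup>2)
          + 1 / (2 * e) * (weight r y p * (vnorm d (y (fst p) - y (snd p)))\<^sup>2)"
        by (simp only: distrib_left mult.left_commute)
      \<comment> \<open>Only the term in \<open>z\<close> gives up its weight; the term in
        \<open>y\<close> has to keep it to match \<open>diss r y\<close>.\<close>
      also have "weight r y p * (e / 2 * (vnorm d (z (fst p) - z (snd p)))\<^sup>2) \<le> M * (e / 2 * (vnorm d (z (fst p) - z (snd p)))\<^sup>2)"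
        using e by (intro mult_right_mono weight_le mult_nonneg_nonneg zero_le_power2) auto
      finally show "- (weight r y p * vdot d (z (fst p) - z (snd p)) (y (fst p) - y (snd p)))
          \<le> M * (e / 2) * (vnorm d (z (fst p) - z (snd p)))\<^sup>2
          + 1 / (2 * e) * (weight r y p * (vnorm d (y (fst p) - y (snd p)))\<^sup>2)"
        by (simp only: mult.assoc)
    qed (use zi in \<open>rule Bochner_Integration.integrable_minus\<close>)
    also have "\<dots> = M * (e / 2) * (LINT p|unit_sq. (vnorm d (z (fst p) - z (snd p)))\<^sup>2) + 1 / (2 * e) * diss r y"
      unfolding diss_def
      by (subst Bochner_Integration.integral_add)
        (intro integrable_mult_right integrable_vnorm_diff_sq z yi,
         intro integrable_mult_right integrable_vnorm_diff_sq z yi,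
         simp only: integral_mult_right_zero)
    also have "M * (e / 2) * (LINT p|unit_sq. (vnorm d (z (fst p) - z (snd p)))\<^sup>2) \<le> M * (e / 2) * (4 * Z)"
      unfolding Z_def using M e by (intro mult_left_mono integral_vnorm_diff_sq_le z) auto
    finally have main: "- (LINT p|unit_sq. weight r y p * vdot d (z (fst p) - z (snd p)) (y (fst p) - y (snd p)))
        \<le> M * (e / 2) * (4 * Z) + 1 / (2 * e) * diss r y" by simp
    have "(LINT p|unit_sq. weight r y p * vdot d (?n y (fst p) - ?n y (snd p)) (y (fst p) - y (snd p)))
        = - (LINT p|unit_sq. weight r y p * vdot d (z (fst p) - z (snd p)) (y (fst p) - y (snd p))) - 1 / (2 * e) * diss r y"
      unfolding split diss_def
      by (subst Bochner_Integration.integral_diff)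
        (rule Bochner_Integration.integrable_minus[OF zi], rule integrable_mult_right[OF yi],
         simp only: integral_mult_right_zero Bochner_Integration.integral_minus)
    moreover have "M * (e / 2) * (4 * Z) = - A" by (simp add: A_def)
    moreover note main
    ultimately show "A \<le> - (LINT p|unit_sq. weight r (x r) p * vdot d (?n (x r) (fst p) - ?n (x r) (snd p)) (x r (fst p) - x r (snd p)))"
      unfolding y_def[symmetric] by linarith
  qed
  moreover have "(LINT r|lebesgue_on {s..t}. A) = (t - s) * A"
    using s by (simp add: measure_restrict_space)
  moreover have "?\<Phi> (x t) - ?\<Phi> (x s) = - (2 * Z) + (1 / (2 * e)) * (V s - V t)"
  proof -
    have "L2_inner d z (x t) - L2_inner d z (x s) = Z"
      using L2_inner_diff_right[OF xs(2,1) z] by (simp only: z_def Z_def L2_norm_sq)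
    then show ?thesis unfolding V_def by (simp add: algebra_simps)
  qed
  ultimately have "(t - s) * A \<le> - (2 * Z) + (1 / (2 * e)) * (V s - V t)" by linarith
  moreover have "1 / (2 * e) = M * \<tau>" using M \<tau> by (simp add: e_def)
  moreover have "- Z \<le> (t - s) * A"
  proof -
    have "(t - s) * (2 * e * M * Z) \<le> \<tau> * (2 * e * M * Z)"
      using s e M by (intro mult_right_mono) (auto simp: Z_def)
    also have "\<dots> = Z" using M \<tau> by (simp add: e_def)
    finally show ?thesis by (simp add: A_def)
  qed
  ultimately show ?thesis unfolding Z_def z_def by simp
qed

lemma contraction:
  assumes t: "0 \<le> t"
  shows "2 * \<tau> * \<mu> * V t \<le> (2 / m + 8 * M * \<tau>\<^sup>2) * (V t - V (t + \<tau>))"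
proof -
  let ?T = "lebesgue_on {t..t+\<tau>}"
  define y where "y = x t"
  define E where "E = V t - V (t + \<tau>)"
  have y: "y \<in> L2_space d" unfolding y_def by (rule x_L2[OF t])
  define q where "q s = (LINT p|unit_sq. b s (fst p) (snd p) * (vnorm d (y (fst p) - y (snd p)))\<^sup>2)" for s
  have q_int: "integrable ?T q" unfolding q_def by (rule averaged_laplacian_inner(1)[OF y t \<tau>])
  have c_int: "integrable ?T (\<lambda>_. 8 * (M * \<tau> * E))"
    by (rule finite_measure.integrable_const) (auto intro: finite_measure_lebesgue_on)
  have "2 * \<tau> * \<mu> * V t \<le> (LINT s|?T. q s)"
    using lambda2_spectral_gap[OF shifted_perp[OF t] t \<tau> gap[OF t]]
    by (simp add: V_def q_def y_def)
  \<comment> \<open>The functional is \<open>- (2 / m)\<close> times the squared distance to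
    \<open>c\<close>, whose derivative along the flow is \<open>2 / m\<close> times the dissipation.
    Hence only \<open>q\<close> minus a constant is integrated.\<close>
  moreover have "(LINT s|?T. q s - 8 * (M * \<tau> * E)) \<le> (- (2 / m)) * V (t + \<tau>) - (- (2 / m)) * V t"
    unfolding V_def
  proof (rule functional_integral_le[OF smooth_functional_scale[OF smooth_functional_sqdist[OF c_L2]] t])
    show "t \<le> t + \<tau>" using \<tau> by simp
    show "integrable ?T (\<lambda>s. q s - 8 * (M * \<tau> * E))" using q_int c_int by simp
    fix s assume s: "t \<le> s" "s \<le> t + \<tau>"
    have s0: "0 \<le> s" using s t by simp
    have xs: "x s \<in> L2_space d" by (rule x_L2[OF s0])
    define z where "z = y - x s"
    have z: "z \<in> L2_space d" unfolding z_def by (rule L2_space_diff[OF y xs])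
    have "(L2_norm d z)\<^sup>2 \<le> M * \<tau> * (V t - V s)"
      using displacement_le[OF t s] L2_norm_diff_commute[OF y xs] by (simp add: z_def y_def)
    also have "\<dots> \<le> M * \<tau> * E"
      \<comment> \<open>The energy lost up to time \<open>s\<close> is at most the loss
        \<open>E\<close> over the whole window, which makes the displacement bound uniform in
        \<open>s\<close>.\<close>
      unfolding E_def using M \<tau> V_antimono[OF s0 s(2)] by (intro mult_left_mono) auto
    finally have zE: "(L2_norm d z)\<^sup>2 \<le> M * \<tau> * E" .
    note di = diss_integrable[OF xs, of s] and zi = integrable_vnorm_diff_sq[OF z]
    have "q s \<le> (LINT p|unit_sq. 2 / m * (weight s (x s) p * (vnorm d (x s (fst p) - x s (snd p)))\<^sup>2)
        + 2 * (vnorm d (z (fst p) - z (snd p)))\<^sup>2)"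
      unfolding q_def
    proof (rule integral_mono_AE)
      have [measurable]: "fst \<in> borel_measurable unit_sq" "snd \<in> borel_measurable unit_sq"
        by (rule measurable_compose[OF measurable_fst ident_measurable_lebesgue_on]
            measurable_compose[OF measurable_snd ident_measurable_lebesgue_on])+
      show "integrable unit_sq (\<lambda>p. b s (fst p) (snd p) * (vnorm d (y (fst p) - y (snd p)))\<^sup>2)"
        unfolding vnorm_sq by (rule integrable_weighted_vdot[OF _ _ y y, of _ 1]) (measurable, rule abs_b_le)
      show "integrable unit_sq (\<lambda>p. 2 / m * (weight s (x s) p * (vnorm d (x s (fst p) - x s (snd p)))\<^sup>2)
          + 2 * (vnorm d (z (fst p) - z (snd p)))\<^sup>2)"
        by (intro Bochner_Integration.integrable_add integrable_mult_right di zi)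
      show "AE p in unit_sq. b s (fst p) (snd p) * (vnorm d (y (fst p) - y (snd p)))\<^sup>2
          \<le> 2 / m * (weight s (x s) p * (vnorm d (x s (fst p) - x s (snd p)))\<^sup>2) + 2 * (vnorm d (z (fst p) - z (snd p)))\<^sup>2"
        using vnorm_diff_bound[OF s0]
      proof eventually_elim
        case (elim p)
        define u where "u = x s (fst p) - x s (snd p)"
        define v where "v = z (fst p) - z (snd p)"
        define \<beta> where "\<beta> = b s (fst p) (snd p)"
        have "y (fst p) - y (snd p) = u - (\<lambda>k. (-1) * v k)"
          by (auto simp: u_def v_def z_def fun_eq_iff)
        then have "(vnorm d (y (fst p) - y (snd p)))\<^sup>2 \<le> 2 * (vnorm d u)\<^sup>2 + 2 * (vnorm d v)\<^sup>2"
          using vnorm_diff_sq_le[of d u "\<lambda>k. (-1) * v k"] by (simp only: vnorm_scale) simp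
        then have "\<beta> * (vnorm d (y (fst p) - y (snd p)))\<^sup>2 \<le> \<beta> * (2 * (vnorm d u)\<^sup>2 + 2 * (vnorm d v)\<^sup>2)"
          unfolding \<beta>_def by (intro mult_left_mono b_nonneg)
        also have "\<dots> = 2 * (\<beta> * (vnorm d u)\<^sup>2) + 2 * (\<beta> * (vnorm d v)\<^sup>2)" by (simp add: algebra_simps)
        also have "\<beta> * (vnorm d v)\<^sup>2 \<le> 1 * (vnorm d v)\<^sup>2"
          unfolding \<beta>_def by (intro mult_right_mono b_le_1) simp
        also have "\<beta> * (vnorm d u)\<^sup>2 \<le> 1 / m * (weight s (x s) p * (vnorm d u)\<^sup>2)"
        proof -
          \<comment> \<open>The invariant ball enters here: almost all pairs of values at time
            \<open>s\<close> are at most \<open>2 * R\<close> apart.\<close>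
          have "m * \<beta> \<le> weight s (x s) p"
            using mult_right_mono[OF \<phi>_ge[OF vnorm_nonneg elim] b_nonneg, of s "fst p" "snd p"]
            by (simp add: weight_def \<beta>_def mult.commute)
          then have "m * \<beta> * (vnorm d u)\<^sup>2 \<le> weight s (x s) p * (vnorm d u)\<^sup>2"
            by (intro mult_right_mono) auto
          then show ?thesis using m by (simp add: field_simps)
        qed
        finally have "\<beta> * (vnorm d (y (fst p) - y (snd p)))\<^sup>2
            \<le> 2 / m * (weight s (x s) p * (vnorm d u)\<^sup>2) + 2 * (vnorm d v)\<^sup>2" by simp
        then show ?case unfolding \<beta>_def u_def v_def .
      qed
    qed
    also have "\<dots> = 2 / m * diss s (x s) + 2 * (LINT p|unit_sq. (vnorm d (z (fst p) - z (snd p)))\<^sup>2)"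
      unfolding diss_def
      by (subst Bochner_Integration.integral_add)
        (rule integrable_mult_right[OF di], rule integrable_mult_right[OF zi], simp only: integral_mult_right_zero)
    also have "\<dots> \<le> 2 / m * diss s (x s) + 8 * (M * \<tau> * E)"
      using integral_vnorm_diff_sq_le[OF z] zE by linarith
    finally have le: "q s - 8 * (M * \<tau> * E) \<le> 2 / m * diss s (x s)" by simp
    have "(\<lambda>k. (- (2 / m)) * (x s - c) i k) - (\<lambda>k. (- (2 / m)) * (x s - c) j k)
        = (\<lambda>k. (- (2 / m)) * (x s i - x s j) k)" for i j
      by (auto simp: fun_eq_iff algebra_simps)
    then have "(LINT p|unit_sq. weight s (x s) p * vdot d ((\<lambda>k. (- (2 / m)) * (x s - c) (fst p) k)
        - (\<lambda>k. (- (2 / m)) * (x s - c) (snd p) k)) (x s (fst p) - x s (snd p))) = - (2 / m) * diss s (x s)"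
      by (simp only: vdot_scale_left vnorm_sq diss_def mult.left_commute[of "weight s (x s) _"] integral_mult_right_zero)
    with le show "q s - 8 * (M * \<tau> * E) \<le> - (LINT p|unit_sq. weight s (x s) p * vdot d ((\<lambda>k. (- (2 / m)) * (x s - c) (fst p) k)
        - (\<lambda>k. (- (2 / m)) * (x s - c) (snd p) k)) (x s (fst p) - x s (snd p)))"
      by simp
  qed
  moreover have "(LINT s|?T. q s - 8 * (M * \<tau> * E)) = (LINT s|?T. q s) - 8 * (M * \<tau> * E) * \<tau>"
    using q_int c_int \<tau> by (simp add: measure_restrict_space)
  moreover have "(- (2 / m)) * V (t + \<tau>) - (- (2 / m)) * V t = 2 / m * E"
    by (simp add: E_def algebra_simps)
  moreover have "(2 / m + 8 * M * \<tau>\<^sup>2) * E = 2 / m * E + 8 * (M * \<tau> * E) * \<tau>"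
    by (simp add: algebra_simps power2_eq_square)
  ultimately show ?thesis unfolding E_def[symmetric] by linarith
qed

end

text \<open>Iteration controls multiples of \<open>\<tau>\<close>; monotonicity carries the bound
  from the last multiple before \<open>t\<close> to \<open>t\<close> itself.\<close>

lemma antimono_contraction_exponential:
  fixes V :: "real \<Rightarrow> real"
  assumes \<tau>: "0 < \<tau>" and q: "0 < q" "q < 1"
    and anti: "\<And>s t. 0 \<le> s \<Longrightarrow> s \<le> t \<Longrightarrow> V t \<le> V s"
    and contr: "\<And>t. 0 \<le> t \<Longrightarrow> V (t + \<tau>) \<le> q * V t" and nonneg: "0 \<le> V 0" and t: "0 \<le> t"
  shows "V t \<le> V 0 / q * exp (ln q * t / \<tau>)"
proof -
  have pow: "V (real n * \<tau>) \<le> q ^ n * V 0" for n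
  proof (induction n)
    case (Suc n)
    have "V (real (Suc n) * \<tau>) = V (real n * \<tau> + \<tau>)" by (simp add: algebra_simps)
    also have "\<dots> \<le> q * V (real n * \<tau>)" using \<tau> by (intro contr) simp
    also have "\<dots> \<le> q * (q ^ n * V 0)" using Suc q by (intro mult_left_mono) auto
    finally show ?case by (simp add: mult.assoc)
  qed simp
  define n where "n = nat \<lfloor>t / \<tau>\<rfloor>"
  have n: "real n \<le> t / \<tau>" "t / \<tau> - 1 \<le> real n"
    using t \<tau> by (simp_all add: n_def)
  have "V t \<le> V (real n * \<tau>)" using n \<tau> by (intro anti) (auto simp: field_simps)
  also have "\<dots> \<le> q ^ n * V 0" by (rule pow)
  also have "q ^ n = exp (ln q * real n)"
    using q exp_of_nat_mult[of n "ln q"] by (simp add: mult.commute)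
  \<comment> \<open>\<open>ln q\<close> is negative, so the lower bound on \<open>n\<close> is used;
    its \<open>- 1\<close> is the origin of the factor \<open>1 / q\<close>.\<close>
  also have "\<dots> \<le> exp (ln q * (t / \<tau> - 1))"
    using n q by (auto intro!: mult_left_mono_neg)
  also have "exp (ln q * (t / \<tau> - 1)) = exp (ln q * t / \<tau>) / q"
    using q by (simp add: right_diff_distrib exp_diff)
  finally show ?thesis using nonneg by (simp add: mult_right_mono mult.commute)
qed

lemma locally_lipschitz_fun_continuous:
  assumes "locally_lipschitz_fun \<phi>"
  shows "continuous_on {0..} \<phi>"
proof (rule continuous_on_eq_continuous_within[THEN iffD2], intro ballI)
  fix r :: real assume "r \<in> {0..}"
  then obtain u C where u: "0 < u" and "C-lipschitz_on (cball r u \<inter> {0..}) \<phi>"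
    using assms unfolding locally_lipschitz_fun_def by force
  then have "continuous (at r within (cball r u \<inter> {0..})) \<phi>"
    using lipschitz_on_continuous_on \<open>r \<in> {0..}\<close> by (force simp: continuous_on_eq_continuous_within)
  moreover have "at r within (cball r u \<inter> {0..}) = at r within {0..}"
    using u by (intro at_within_nhd[of r "ball r u"]) auto
  ultimately show "continuous (at r within {0..}) \<phi>" by simp
qed

theorem theorem4p8:
  fixes \<phi> :: "real \<Rightarrow> real" and R \<tau> \<mu> :: real
  assumes "\<forall>r\<ge>0. 0 < \<phi> r"
    and "locally_lipschitz_fun \<phi>"
    and "bounded (\<phi> ` {0..})"
    and "0 < R" and "0 < \<tau>" and "0 < \<mu>" and "\<mu> \<le> 1"
  shows "\<exists>\<alpha>>0. \<exists>\<gamma>>0.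
    \<forall>(d :: nat) (a :: real \<Rightarrow> real \<Rightarrow> real \<Rightarrow> real)
      (x0 :: real \<Rightarrow> nat \<Rightarrow> real) (x :: real \<Rightarrow> real \<Rightarrow> nat \<Rightarrow> real).
      1 \<le> d \<longrightarrow>
      x0 \<in> Linf_space d \<longrightarrow> Linf_norm d x0 \<le> ereal R \<longrightarrow>
      measurable_kernel a \<longrightarrow> symmetric_kernel a \<longrightarrow>
      (\<forall>t\<ge>0. lambda2 d (averaged_operator (graph_laplacian a) \<tau> t) \<ge> \<mu>) \<longrightarrow>
      graphon_solution d a \<phi> x0 x \<longrightarrow>
      (\<forall>t\<ge>0. L2_norm d (x t - (\<lambda>_. barycenter x0))
               \<le> \<alpha> * L2_norm d (x 0 - (\<lambda>_. barycenter x0)) * exp (- \<gamma> * \<mu> * t))"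
proof -
  have cont: "continuous_on {0..} \<phi>" by (rule locally_lipschitz_fun_continuous[OF assms(2)])
  from assms(3) obtain M where M: "0 < M" "\<And>r. 0 \<le> r \<Longrightarrow> \<phi> r \<le> M"
    unfolding bounded_pos by (auto simp: abs_le_iff)
  \<comment> \<open>A continuous positive function has a positive minimum on a compact interval.
    \<open>M\<close> and \<open>m\<close> thus depend on \<open>\<phi>\<close> and \<open>R\<close>
    only, and are fixed before \<open>d\<close>, \<open>a\<close>, \<open>x0\<close> and
    \<open>x\<close> appear.\<close>
  have "\<exists>r\<in>{0..2 * R}. \<forall>s\<in>{0..2 * R}. \<phi> r \<le> \<phi> s"
    using assms(4) by (intro continuous_attains_inf continuous_on_subset[OF cont]) auto
  then obtain r0 where r0: "0 \<le> r0" "\<And>s. 0 \<le> s \<Longrightarrow> s \<le> 2 * R \<Longrightarrow> \<phi> r0 \<le> \<phi> s" by auto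
  define m where "m = \<phi> r0"
  have m: "0 < m" using r0(1) assms(1) by (simp add: m_def)
  define K where "K = 2 / m + 8 * M * \<tau>\<^sup>2"
  have K: "0 < K" using m M assms(5) by (auto simp: K_def intro!: add_pos_nonneg)
  \<comment> \<open>\<open>1 - 2 * \<tau> * \<mu> / K\<close> is the factor from
    \<open>contraction\<close>; the maximum with 1/2 guarantees a positive argument for
    \<open>ln\<close>.\<close>
  define q where "q = max (1 / 2) (1 - 2 * \<tau> * \<mu> / K)"
  have q: "0 < q" "q < 1" using K assms(5,6) by (auto simp: q_def)
  \<comment> \<open>The rate \<open>- ln q / \<tau>\<close> of \<open>V\<close> is halved for the
    norm, and divided by \<open>\<mu>\<close> because the claimed exponent is
    \<open>- \<gamma> * \<mu> * t\<close>. Likewise \<open>\<alpha>\<close> is the square root of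
    the factor \<open>1 / q\<close>.\<close>
  define \<gamma> where "\<gamma> = - ln q / (2 * \<tau> * \<mu>)"
  have \<gamma>: "0 < \<gamma>" using q assms(5,6) ln_less_zero[OF q] by (simp add: \<gamma>_def divide_neg_pos)
  have \<alpha>: "0 < sqrt (1 / q)" using q by simp
  show ?thesis
  proof (rule exI[of _ "sqrt (1 / q)"], rule conjI[OF \<alpha>], rule exI[of _ \<gamma>], rule conjI[OF \<gamma>], intro allI impI)
    fix d a x0 x t
    assume x0: "x0 \<in> Linf_space d" "Linf_norm d x0 \<le> ereal R"
      and a: "measurable_kernel a" "symmetric_kernel a"
      and gap: "\<forall>t\<ge>0. \<mu> \<le> lambda2 d (averaged_operator (graph_laplacian a) \<tau> t)"
      and sol: "graphon_solution d a \<phi> x0 x" and t: "(0 :: real) \<le> t"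
    obtain b where b: "kernel_version a b"
      using kernel_version_exists[OF a] by blast
    have x0m: "(\<lambda>i. x0 i k) \<in> borel_measurable unit_leb" if "k < d" for k
      using x0(1) that by (simp add: Linf_space_def)
    have x0b: "AE i in unit_leb. vnorm d (x0 i) \<le> R"
    proof -
      have "(\<lambda>i. ereal (vnorm d (x0 i))) \<in> borel_measurable unit_leb"
        by (intro borel_measurable_ereal vnorm_measurable x0m)
      from esssup_AE[of "\<lambda>i. ereal (vnorm d (x0 i))" unit_leb] show ?thesis
        by eventually_elim (use x0(2) in \<open>auto simp: Linf_norm_def dest: order_trans\<close>)
    qed
    interpret kernel_version a b by (rule b)
    interpret graphon_flow a b d \<phi> x0 x R M m \<mu> \<tau>
      by unfold_locales
        (use cont M m r0(2) assms gap sol x0m x0b in \<open>auto simp: m_def less_imp_le\<close>)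
    have contr: "V (t + \<tau>) \<le> q * V t" if t: "0 \<le> t" for t
    proof -
      have "2 * \<tau> * \<mu> / K * V t \<le> V t - V (t + \<tau>)"
        using contraction[OF t] K unfolding K_def[symmetric] by (simp add: field_simps)
      then have "V (t + \<tau>) \<le> (1 - 2 * \<tau> * \<mu> / K) * V t" by (simp add: left_diff_distrib)
      also have "\<dots> \<le> q * V t" by (intro mult_right_mono) (auto simp: q_def V_def)
      finally show ?thesis .
    qed
    have "V t \<le> V 0 / q * exp (ln q * t / \<tau>)"
      by (rule antimono_contraction_exponential[where V = V, OF assms(5) q V_antimono contr _ t]) (auto simp: V_def)
    also have "ln q * t / \<tau> = 2 * (- \<gamma> * \<mu> * t)"
      using assms(5,6) by (simp add: \<gamma>_def)
    also have "V 0 / q * exp (2 * (- \<gamma> * \<mu> * t))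
        = (sqrt (1 / q) * L2_norm d (x 0 - (\<lambda>_. barycenter x0)) * exp (- \<gamma> * \<mu> * t))\<^sup>2"
      unfolding exp_double power_mult_distrib V_def using q by (simp add: field_simps)
    finally show "L2_norm d (x t - (\<lambda>_. barycenter x0))
        \<le> sqrt (1 / q) * L2_norm d (x 0 - (\<lambda>_. barycenter x0)) * exp (- \<gamma> * \<mu> * t)"
      unfolding V_def using q by (intro power2_le_imp_le[of "L2_norm d (x t - (\<lambda>_. barycenter x0))"]) auto
  qed
qed

end
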